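(* Let $X$ be a Hausdorff topological space, let $Y$ be a closed subset of $X$, and let $k\geqslant 0$ be an integer. If every point $y\in Y$ admits a neighborhood system $(U_\varepsilon)_\varepsilon$ in $X$ such that each pair $(U_\varepsilon,U_\varepsilon\smallsetminus Y)$ is $k$-connected, then the pair $(X,X\smallsetminus Y)$ is $k$-connected.
   Context: A neighborhood system of $y$ is a family of neighborhoods of $y$ such that every neighborhood of $y$ contains a member of the family. For a topological space $X$ and a subset $U\subset X$, the pair $(X,U)$ is $0$-connected if any point of $X$ can be connected by a continuous path in $X$ to a point of $U$. The pair is $k$-connected if moreover, for all integers $1\leqslant\ell\leqslant k$, every continuous map $(I^\ell,\partial I^\ell)\to(X,U)$ from the closed cube $I^\ell=[0,1]^\ell$ sending its boundary into $U$ is homotopic in $X$, relative to $\partial I^\ell$, to a map $I^\ell\to U$. *)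

theory Defs
  imports "HOL-Analysis.Analysis"
begin

text \<open>Neighborhoods need not be open.\<close>

definition neighborhood :: "'a topology \<Rightarrow> 'a \<Rightarrow> 'a set \<Rightarrow> bool" where
  "neighborhood X y U \<longleftrightarrow> U \<subseteq> topspace X \<and> (\<exists>V. openin X V \<and> y \<in> V \<and> V \<subseteq> U)"

definition neighborhood_system :: "'a topology \<Rightarrow> 'a \<Rightarrow> 'a set set \<Rightarrow> bool" where
  "neighborhood_system X y \<U> \<longleftrightarrow>
     (\<forall>U\<in>\<U>. neighborhood X y U) \<and>
     (\<forall>W. neighborhood X y W \<longrightarrow> (\<exists>U\<in>\<U>. U \<subseteq> W))"

lemma ex_neighborhood_system_iff:
  "(\<exists>\<U>. neighborhood_system X y \<U> \<and> (\<forall>U\<in>\<U>. P U)) \<longleftrightarrow> neighbourhood_base_at y P X"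
proof
  assume "\<exists>\<U>. neighborhood_system X y \<U> \<and> (\<forall>U\<in>\<U>. P U)"
  then obtain \<U> where \<U>: "neighborhood_system X y \<U>" "\<forall>U\<in>\<U>. P U"
    by blast
  show "neighbourhood_base_at y P X"
    unfolding neighbourhood_base_at_def
  proof (intro allI impI)
    fix W assume W: "openin X W \<and> y \<in> W"
    then have "neighborhood X y W"
      unfolding neighborhood_def using openin_subset by blast
    then obtain U where "U \<in> \<U>" "U \<subseteq> W"
      using \<U> unfolding neighborhood_system_def by blast
    then show "\<exists>V U. openin X V \<and> P U \<and> y \<in> V \<and> V \<subseteq> U \<and> U \<subseteq> W"
      using \<U> unfolding neighborhood_system_def neighborhood_def by meson
  qed
next
  assume base: "neighbourhood_base_at y P X"
  have "\<exists>U. neighborhood X y U \<and> P U \<and> U \<subseteq> W" if W: "neighborhood X y W" for W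
  proof -
    obtain O' where O': "openin X O'" "y \<in> O'" "O' \<subseteq> W"
      using W unfolding neighborhood_def by blast
    then obtain V U where "openin X V" "P U" "y \<in> V" "V \<subseteq> U" "U \<subseteq> O'"
      using base unfolding neighbourhood_base_at_def by meson
    then show ?thesis
      using O' openin_subset[OF O'(1)] unfolding neighborhood_def
      by (meson order_trans)
  qed
  then have "neighborhood_system X y {U. neighborhood X y U \<and> P U}"
    unfolding neighborhood_system_def by blast
  then show "\<exists>\<U>. neighborhood_system X y \<U> \<and> (\<forall>U\<in>\<U>. P U)"
    by blast
qed

text \<open>Points of the \<open>l\<close>-cube are the extensional functions \<open>{..<l} \<rightarrow> [0,1]\<close>.\<close>

definition cube :: "nat \<Rightarrow> (nat \<Rightarrow> real) topology" where
  "cube l = product_topology (\<lambda>i. top_of_set {0..1}) {..<l}"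

definition cube_boundary :: "nat \<Rightarrow> (nat \<Rightarrow> real) set" where
  "cube_boundary l = {x \<in> topspace (cube l). \<exists>i<l. x i = 0 \<or> x i = 1}"

text \<open>
  The property passed to \<open>homotopic_with\<close> says that every stage of the homotopy agrees
  with \<open>f\<close> on the boundary, so the homotopy is relative to the boundary.
\<close>

definition k_connected_pair :: "nat \<Rightarrow> 'a topology \<Rightarrow> 'a set \<Rightarrow> bool" where
  "k_connected_pair k X U \<longleftrightarrow>
     (\<forall>x\<in>topspace X. \<exists>p. pathin X p \<and> p 0 = x \<and> p 1 \<in> U) \<and>
     (\<forall>l f. 1 \<le> l \<and> l \<le> k \<and> continuous_map (cube l) X f \<and> f ` cube_boundary l \<subseteq> U \<longrightarrow>
        (\<exists>g. homotopic_with (\<lambda>h. \<forall>x\<in>cube_boundary l. h x = f x) (cube l) X f g \<and>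
             g ` topspace (cube l) \<subseteq> U))"

end

theory Submission
  imports Defs
begin

text \<open>
  A map \<open>f\<close> from the \<open>l\<close>-cube to \<open>X\<close> that sends the boundary off \<open>Y\<close> is pushed off \<open>Y\<close> by
  induction over the skeleta of a fine cubical subdivision. A cell whose image misses \<open>Y\<close> stays
  where it is; since boundary points lie in such cells, the homotopy is automatically relative to
  the boundary. A cell whose image meets \<open>Y\<close> lies in a neighborhood \<open>U\<close> for which the pair
  \<open>(U, U - Y)\<close> is \<open>k\<close>-connected. The homotopy already built on the rim of the cell is first extended over
  the cell inside \<open>U\<close> (\<open>cube_homotopy_extension\<close>); the resulting end map has its rim in \<open>U - Y\<close>,
  so \<open>k\<close>-connectedness of the pair compresses it into \<open>U - Y\<close> (\<open>cube_compression\<close>, transported to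
  cells in \<open>cell_compression\<close>). Since only finitely many closed cells occur, the homotopies on
  cells paste together (\<open>extend_over_next_skeleton\<close>).

  The difficulty is that the homotopy moves the rim of a cell, and it has to stay inside the
  neighborhood belonging to that cell. The neighborhoods must therefore increase along faces:
  if \<open>A\<close> is a proper face of \<open>B\<close>, the neighborhood for \<open>A\<close> must lie in the one for \<open>B\<close>. Such a choice
  cannot be made one cell at a time, because shrinking neighborhoods forces a finer subdivision.
  Instead a neighborhood \<open>U j A\<close> is provided for every dimension \<open>j \<le> l\<close> and every sufficiently small
  subset \<open>A\<close> of the cube whose image meets \<open>Y\<close>, with \<open>U i A \<subseteq> U j B\<close> whenever \<open>A \<subseteq> B\<close> and \<open>i < j\<close>
  (\<open>nested_neighborhoods\<close>). Compactness of the cube and a Lebesgue number give finitely many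
  candidates in each dimension, descending from dimension \<open>l\<close> to \<open>0\<close>, and only at the end is the
  mesh of the subdivision fixed.
\<close>

section \<open>Nested neighborhoods of small sets\<close>

definition fattening :: "'c::metric_space set \<Rightarrow> real \<Rightarrow> 'c set \<Rightarrow> 'c set" where
  "fattening K r A = {x \<in> K. \<exists>a\<in>A. dist a x < r}"

lemma fattening_mono: "A \<subseteq> B \<Longrightarrow> fattening K r A \<subseteq> fattening K r B"
  unfolding fattening_def by blast

lemma subset_fattening: "A \<subseteq> K \<Longrightarrow> r > 0 \<Longrightarrow> A \<subseteq> fattening K r A"
  unfolding fattening_def by force

text \<open>
  These are the sets on which something has to be done: sets missing \<open>Y\<close> under \<open>f\<close> are left alone.
\<close>
definition meeting_sets :: "'c::metric_space set \<Rightarrow> ('c \<Rightarrow> 'a) \<Rightarrow> 'a set \<Rightarrow> real \<Rightarrow> 'c set set" where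
  "meeting_sets K f Y \<delta> = {A. A \<subseteq> K \<and> diameter A \<le> \<delta> \<and> f ` A \<inter> Y \<noteq> {}}"

lemma meeting_sets_mono: "A \<in> meeting_sets K f Y \<delta> \<Longrightarrow> \<delta> \<le> \<delta>' \<Longrightarrow> A \<in> meeting_sets K f Y \<delta>'"
  unfolding meeting_sets_def by simp

text \<open>
  This is the Lebesgue number lemma for the compact preimage of \<open>Y\<close>, in a form that can be iterated.
  Each point \<open>z\<close> of the preimage receives a neighborhood \<open>U z\<close> of \<open>f z\<close> inside every member of \<open>\<W>\<close> that
  contains \<open>f z\<close>. A small set \<open>A\<close> is assigned the \<open>U z\<close> of a point \<open>z\<close> near it; then \<open>z\<close> need not lie in \<open>A\<close>,
  but it lies in the fattening of \<open>A\<close>, so \<open>U z\<close> is inside every \<open>W\<close> that contains the image of the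
  fattening. This is why fattenings occur both in what is required of \<open>W\<close> and in what is
  guaranteed for \<open>V\<close>: the open sets \<open>V\<close> found here serve as the family \<open>\<W>\<close> of the next refinement.
\<close>
lemma uniform_neighborhood_refinement:
  fixes f :: "'c::metric_space \<Rightarrow> 'a" and r :: real
  assumes K: "compact K" and f: "continuous_map (top_of_set K) X f" and Y: "closedin X Y"
    and base: "\<forall>y\<in>Y. neighbourhood_base_at y P X"
    and \<W>: "finite \<W>" "\<forall>W\<in>\<W>. openin X W" and "r > 0"
  obtains \<delta> \<V> where "\<delta> > 0" "finite \<V>" "\<And>V U. (V, U) \<in> \<V> \<Longrightarrow> openin X V \<and> P U \<and> V \<subseteq> U"
    "\<And>A. A \<in> meeting_sets K f Y \<delta> \<Longrightarrow>
       \<exists>(V, U)\<in>\<V>. f ` fattening K \<delta> A \<subseteq> V \<and>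
         (\<forall>W\<in>\<W>. f ` fattening K r A \<subseteq> W \<longrightarrow> U \<subseteq> W)"
proof -
  define Z where "Z = {x \<in> K. f x \<in> Y}"
  have "closedin (top_of_set K) Z"
    using f Y unfolding Z_def continuous_map_closedin by simp
  then have Z: "compact Z"
    using K closedin_compact by blast
  have "\<exists>V U G. openin X V \<and> P U \<and> V \<subseteq> U \<and> (\<forall>W\<in>\<W>. f z \<in> W \<longrightarrow> U \<subseteq> W) \<and>
          open G \<and> z \<in> G \<and> G \<subseteq> ball z r \<and> f ` (K \<inter> G) \<subseteq> V" if z: "z \<in> Z" for z
  proof -
    \<comment> \<open>Finiteness of \<open>\<W>\<close> makes this intersection open.\<close>
    define O' where "O' = topspace X \<inter> \<Inter>{W \<in> \<W>. f z \<in> W}"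
    have "openin X O'"
      unfolding O'_def by (rule openin_Int_Inter) (use \<W> in simp_all)
    moreover have "f z \<in> O'"
      using z f unfolding O'_def Z_def continuous_map_def by auto
    moreover have "f z \<in> Y"
      using z unfolding Z_def by simp
    then have "neighbourhood_base_at (f z) P X"
      using base by blast
    ultimately obtain V U where VU: "openin X V" "P U" "f z \<in> V" "V \<subseteq> U" "U \<subseteq> O'"
      unfolding neighbourhood_base_at_def by meson
    have "openin (top_of_set K) {x \<in> K. f x \<in> V}"
      using f VU(1) unfolding continuous_map_def by simp
    then obtain T where T: "open T" "{x \<in> K. f x \<in> V} = K \<inter> T"
      unfolding openin_open by blast
    have "z \<in> T"
      using T(2) VU(3) z unfolding Z_def by blast
    then have "z \<in> T \<inter> ball z r" "open (T \<inter> ball z r)"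
      using T(1) \<open>r > 0\<close> by auto
    moreover have "\<forall>W\<in>\<W>. f z \<in> W \<longrightarrow> U \<subseteq> W"
      using VU(5) unfolding O'_def by blast
    moreover have "f ` (K \<inter> (T \<inter> ball z r)) \<subseteq> V"
      using T(2) by blast
    ultimately show ?thesis
      using VU(1,2,4) by (meson inf_le2)
  qed
  then obtain V U G where "\<forall>z\<in>Z. openin X (V z) \<and> P (U z) \<and> V z \<subseteq> U z \<and>
      (\<forall>W\<in>\<W>. f z \<in> W \<longrightarrow> U z \<subseteq> W) \<and> open (G z) \<and> z \<in> G z \<and> G z \<subseteq> ball z r \<and> f ` (K \<inter> G z) \<subseteq> V z"
    by metis
  then have V: "\<And>z. z \<in> Z \<Longrightarrow> openin X (V z) \<and> P (U z) \<and> V z \<subseteq> U z"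
    and U: "\<And>z W. \<lbrakk>z \<in> Z; W \<in> \<W>; f z \<in> W\<rbrakk> \<Longrightarrow> U z \<subseteq> W"
    and G: "\<And>z. z \<in> Z \<Longrightarrow> open (G z)" "\<And>z. z \<in> Z \<Longrightarrow> z \<in> G z" "\<And>z. z \<in> Z \<Longrightarrow> G z \<subseteq> ball z r"
    and fG: "\<And>z. z \<in> Z \<Longrightarrow> f ` (K \<inter> G z) \<subseteq> V z"
    by simp_all
  obtain F where F: "F \<subseteq> Z" "finite F" "Z \<subseteq> (\<Union>z\<in>F. G z)"
    using compactE_image[OF Z, of Z G] G(1,2) by blast
  obtain e where e: "e > 0" "\<And>x. x \<in> Z \<Longrightarrow> \<exists>B\<in>G ` F. ball x e \<subseteq> B"
    using Heine_Borel_lemma[OF Z, of "G ` F"] F G(1) by blast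
  show thesis
  proof (rule that[of "e / 3" "(\<lambda>z. (V z, U z)) ` F"])
    fix A assume "A \<in> meeting_sets K f Y (e / 3)"
    then have A: "A \<subseteq> K" "diameter A \<le> e / 3" "f ` A \<inter> Y \<noteq> {}"
      by (simp_all add: meeting_sets_def)
    then obtain a where a: "a \<in> A" "a \<in> Z"
      unfolding Z_def by blast
    then obtain z where z: "z \<in> F" "ball a e \<subseteq> G z"
      using e by blast
    have zZ: "z \<in> Z"
      using z F by blast
    \<comment> \<open>A third of the Lebesgue number leaves room for the diameter of \<open>A\<close> plus the fattening.\<close>
    have near: "x \<in> G z" if "b \<in> A" "dist b x < e / 3" for b x
    proof -
      have "dist a x \<le> dist a b + dist b x"
        by (rule dist_triangle)
      moreover have "dist a b \<le> e / 3"
        using diameter_bounded_bound[OF bounded_subset[OF compact_imp_bounded[OF K] A(1)] a(1) that(1)] A(2) by simp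
      ultimately have "x \<in> ball a e"
        using that e(1) by simp
      then show ?thesis
        using z(2) by blast
    qed
    have "f ` fattening K (e / 3) A \<subseteq> f ` (K \<inter> G z)"
      by (rule image_mono) (use near in \<open>auto simp: fattening_def\<close>)
    then have "f ` fattening K (e / 3) A \<subseteq> V z"
      using fG[OF zZ] by (rule order_trans)
    moreover have "U z \<subseteq> W" if W: "W \<in> \<W>" "f ` fattening K r A \<subseteq> W" for W
    proof -
      have "a \<in> G z"
        using z e(1) by (meson centre_in_ball subsetD)
      then have "dist a z < r"
        using G(3)[OF zZ] by (auto simp: dist_commute)
      then have "z \<in> fattening K r A"
        using a(1) zZ unfolding Z_def fattening_def by blast
      then show ?thesis
        using U[OF zZ W(1)] W(2) by (meson image_subset_iff)
    qed
    ultimately show "\<exists>(V, U)\<in>(\<lambda>z. (V z, U z)) ` F. f ` fattening K (e / 3) A \<subseteq> V \<and>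
         (\<forall>W\<in>\<W>. f ` fattening K r A \<subseteq> W \<longrightarrow> U \<subseteq> W)"
      using z(1) by (intro bexI[of _ "(V z, U z)"]) simp_all
  next
    show "openin X V' \<and> P U' \<and> V' \<subseteq> U'" if "(V', U') \<in> (\<lambda>z. (V z, U z)) ` F" for V' U'
    proof -
      from that obtain z where "z \<in> F" "V' = V z" "U' = U z"
        by (elim imageE) simp
      then show ?thesis
        using V[of z] F(1) by (simp add: subset_iff)
    qed
  qed (use e(1) F(2) in simp_all)
qed

text \<open>
  The induction adds a new largest dimension on top: one refinement of \<open>\<W>\<close> gives the neighborhoods
  for dimension \<open>Suc n\<close>, and the induction hypothesis, applied to the open sets \<open>V\<close> just obtained in
  place of \<open>\<W>\<close>, gives all lower dimensions. The clause about \<open>\<W>\<close> is what makes the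
  induction work: for \<open>A \<subseteq> B\<close> it reduces \<open>U n A \<subseteq> U (Suc n) B\<close> to the claim that the fattening of \<open>A\<close>
  is mapped into the open set chosen for \<open>B\<close>, and this holds already for the larger fattening of \<open>B\<close>.
\<close>
lemma nested_neighborhoods_below:
  fixes f :: "'c::metric_space \<Rightarrow> 'a" and r :: real and n :: nat
  assumes K: "compact K" and f: "continuous_map (top_of_set K) X f" and Y: "closedin X Y"
    and base: "\<forall>y\<in>Y. neighbourhood_base_at y P X"
    and "finite \<W>" "\<forall>W\<in>\<W>. openin X W" "r > 0"
  shows "\<exists>\<delta>>0. \<exists>U.
     (\<forall>A\<in>meeting_sets K f Y \<delta>. \<forall>j\<le>n. P (U j A) \<and> f ` A \<subseteq> U j A) \<and>
     (\<forall>A\<in>meeting_sets K f Y \<delta>. \<forall>B\<in>meeting_sets K f Y \<delta>. \<forall>i j.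
        A \<subseteq> B \<longrightarrow> i < j \<longrightarrow> j \<le> n \<longrightarrow> U i A \<subseteq> U j B) \<and>
     (\<forall>A\<in>meeting_sets K f Y \<delta>. \<forall>W\<in>\<W>. f ` fattening K r A \<subseteq> W \<longrightarrow> U n A \<subseteq> W)"
  using assms(5-)
proof (induction n arbitrary: \<W> r)
  case 0
  obtain \<delta> \<V> where \<delta>: "\<delta> > 0" and \<V>: "\<And>V U. (V, U) \<in> \<V> \<Longrightarrow> openin X V \<and> P U \<and> V \<subseteq> U"
    and fit: "\<And>A. A \<in> meeting_sets K f Y \<delta> \<Longrightarrow>
       \<exists>(V, U)\<in>\<V>. f ` fattening K \<delta> A \<subseteq> V \<and> (\<forall>W\<in>\<W>. f ` fattening K r A \<subseteq> W \<longrightarrow> U \<subseteq> W)"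
    by (rule uniform_neighborhood_refinement[OF K f Y base 0]) (rule that, assumption+)
  have "\<exists>U. P U \<and> f ` A \<subseteq> U \<and> (\<forall>W\<in>\<W>. f ` fattening K r A \<subseteq> W \<longrightarrow> U \<subseteq> W)"
    if A: "A \<in> meeting_sets K f Y \<delta>" for A
  proof -
    obtain V U where VU: "(V, U) \<in> \<V>" "f ` fattening K \<delta> A \<subseteq> V"
      "\<forall>W\<in>\<W>. f ` fattening K r A \<subseteq> W \<longrightarrow> U \<subseteq> W"
      using fit[OF A] by blast
    have "A \<subseteq> fattening K \<delta> A"
      using A \<delta> by (intro subset_fattening) (simp_all add: meeting_sets_def)
    then show ?thesis
      using VU \<V>[OF VU(1)] by (meson image_mono order_trans)
  qed
  then have "\<forall>A\<in>meeting_sets K f Y \<delta>. \<exists>U. P U \<and> f ` A \<subseteq> U \<and> (\<forall>W\<in>\<W>. f ` fattening K r A \<subseteq> W \<longrightarrow> U \<subseteq> W)"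
    by blast
  from bchoice[OF this] obtain U where U: "\<forall>A\<in>meeting_sets K f Y \<delta>.
      P (U A) \<and> f ` A \<subseteq> U A \<and> (\<forall>W\<in>\<W>. f ` fattening K r A \<subseteq> W \<longrightarrow> U A \<subseteq> W)" ..
  then show ?case
    using \<delta> by (intro exI[of _ \<delta>] conjI exI[of _ "\<lambda>_. U"]) simp_all
next
  case (Suc n)
  obtain \<delta>1 \<V> where \<delta>1: "\<delta>1 > 0" "finite \<V>"
    and \<V>: "\<And>V U. (V, U) \<in> \<V> \<Longrightarrow> openin X V \<and> P U \<and> V \<subseteq> U"
    and fit: "\<And>A. A \<in> meeting_sets K f Y \<delta>1 \<Longrightarrow>
       \<exists>(V, U)\<in>\<V>. f ` fattening K \<delta>1 A \<subseteq> V \<and> (\<forall>W\<in>\<W>. f ` fattening K r A \<subseteq> W \<longrightarrow> U \<subseteq> W)"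
    by (rule uniform_neighborhood_refinement[OF K f Y base Suc.prems]) (rule that, assumption+)
  have "\<forall>A\<in>meeting_sets K f Y \<delta>1. \<exists>VU. VU \<in> \<V> \<and> f ` fattening K \<delta>1 A \<subseteq> fst VU \<and>
       (\<forall>W\<in>\<W>. f ` fattening K r A \<subseteq> W \<longrightarrow> snd VU \<subseteq> W)"
    using fit by (fastforce simp: case_prod_beta)
  from bchoice[OF this] obtain VT where VT: "\<forall>A\<in>meeting_sets K f Y \<delta>1.
       VT A \<in> \<V> \<and> f ` fattening K \<delta>1 A \<subseteq> fst (VT A) \<and>
       (\<forall>W\<in>\<W>. f ` fattening K r A \<subseteq> W \<longrightarrow> snd (VT A) \<subseteq> W)" ..
  have \<V>': "P (snd VU) \<and> fst VU \<subseteq> snd VU" if "VU \<in> \<V>" for VU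
    using \<V>[of "fst VU" "snd VU"] that by simp
  have "\<forall>W\<in>fst ` \<V>. openin X W"
    using \<V> by auto
  from Suc.IH[OF finite_imageI[OF \<delta>1(2)] this \<delta>1(1)] obtain \<delta>2 U where \<delta>2: "\<delta>2 > 0"
    and U: "\<forall>A\<in>meeting_sets K f Y \<delta>2. \<forall>j\<le>n. P (U j A) \<and> f ` A \<subseteq> U j A"
      "\<forall>A\<in>meeting_sets K f Y \<delta>2. \<forall>B\<in>meeting_sets K f Y \<delta>2. \<forall>i j.
        A \<subseteq> B \<longrightarrow> i < j \<longrightarrow> j \<le> n \<longrightarrow> U i A \<subseteq> U j B"
      "\<forall>A\<in>meeting_sets K f Y \<delta>2. \<forall>W\<in>fst ` \<V>. f ` fattening K \<delta>1 A \<subseteq> W \<longrightarrow> U n A \<subseteq> W"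
    by (elim exE conjE)
  define \<delta> where "\<delta> = min \<delta>1 \<delta>2"
  define U' where "U' = (\<lambda>j A. if j \<le> n then U j A else snd (VT A))"
  have \<delta>12: "A \<in> meeting_sets K f Y \<delta>1" "A \<in> meeting_sets K f Y \<delta>2" if "A \<in> meeting_sets K f Y \<delta>" for A
    using that by (auto elim: meeting_sets_mono simp: \<delta>_def)
  have PU: "P (U' j A) \<and> f ` A \<subseteq> U' j A" if A: "A \<in> meeting_sets K f Y \<delta>" for j A
  proof -
    have "A \<subseteq> fattening K \<delta>1 A"
      using A \<delta>1 by (intro subset_fattening) (simp_all add: meeting_sets_def)
    then have "f ` A \<subseteq> snd (VT A)"
      using VT \<delta>12(1)[OF A] \<V>' by (meson image_mono order_trans)
    then show ?thesis
      using U(1) VT \<delta>12[OF A] \<V>' by (simp add: U'_def)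
  qed
  have mono: "U' i A \<subseteq> U' j B"
    if A: "A \<in> meeting_sets K f Y \<delta>" and B: "B \<in> meeting_sets K f Y \<delta>" "A \<subseteq> B" and ij: "i < j" "j \<le> Suc n"
    for A B i j
  proof (cases "j \<le> n")
    case True
    then show ?thesis
      using U(2) \<delta>12(2)[OF A] \<delta>12(2)[OF B(1)] B(2) ij by (simp add: U'_def)
  next
    case False
    have "U i A \<subseteq> U n A"
      using U(2) \<delta>12(2)[OF A] ij by (cases "i = n") auto
    also have "f ` fattening K \<delta>1 A \<subseteq> fst (VT B)"
      using fattening_mono[OF B(2)] VT \<delta>12(1)[OF B(1)] by (meson image_mono order_trans)
    then have "U n A \<subseteq> fst (VT B)"
      using U(3) VT \<delta>12(2)[OF A] \<delta>12(1)[OF B(1)] by blast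
    also have "\<dots> \<subseteq> snd (VT B)"
      using \<V>' VT \<delta>12(1)[OF B(1)] by blast
    finally show ?thesis
      using False ij by (simp add: U'_def)
  qed
  have "U' (Suc n) A \<subseteq> W" if "A \<in> meeting_sets K f Y \<delta>" "W \<in> \<W>" "f ` fattening K r A \<subseteq> W" for A W
    using VT \<delta>12(1)[OF that(1)] that by (simp add: U'_def)
  moreover have "\<delta> > 0"
    using \<delta>1 \<delta>2 by (simp add: \<delta>_def)
  ultimately show ?case
    using PU mono by (intro exI[of _ \<delta>] conjI exI[of _ U'] ballI allI impI) simp_all
qed

lemma nested_neighborhoods:
  fixes f :: "'c::metric_space \<Rightarrow> 'a" and n :: nat
  assumes "compact K" "continuous_map (top_of_set K) X f" "closedin X Y"
    and "\<forall>y\<in>Y. neighbourhood_base_at y P X"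
  obtains \<delta> U where "\<delta> > 0"
    "\<And>A j. \<lbrakk>A \<in> meeting_sets K f Y \<delta>; j \<le> n\<rbrakk> \<Longrightarrow> P (U j A) \<and> f ` A \<subseteq> U j A"
    "\<And>A B i j. \<lbrakk>A \<in> meeting_sets K f Y \<delta>; B \<in> meeting_sets K f Y \<delta>; A \<subseteq> B; i < j; j \<le> n\<rbrakk>
       \<Longrightarrow> U i A \<subseteq> U j B"
proof -
  have "finite {}" "\<forall>W\<in>{}. openin X W" "(1::real) > 0"
    by simp_all
  from nested_neighborhoods_below[OF assms this, where n = n] obtain \<delta> U where "\<delta> > 0"
    "\<forall>A\<in>meeting_sets K f Y \<delta>. \<forall>j\<le>n. P (U j A) \<and> f ` A \<subseteq> U j A"
    "\<forall>A\<in>meeting_sets K f Y \<delta>. \<forall>B\<in>meeting_sets K f Y \<delta>. \<forall>i j.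
        A \<subseteq> B \<longrightarrow> i < j \<longrightarrow> j \<le> n \<longrightarrow> U i A \<subseteq> U j B"
    by (elim exE conjE)
  then show thesis
    by (intro that[of \<delta> U]) simp_all
qed

section \<open>The cube as a compact metric space\<close>

lemma topspace_cube: "topspace (cube l) = PiE {..<l} (\<lambda>_. {0..1})"
  by (simp add: cube_def)

lemma continuous_map_into_cube:
  "continuous_map T (cube l) h \<longleftrightarrow>
     h ` topspace T \<subseteq> topspace (cube l) \<and> (\<forall>i<l. continuous_map T euclideanreal (\<lambda>x. h x i))"
  unfolding cube_def continuous_map_componentwise continuous_map_in_subtopology
  by (fastforce simp: PiE_iff image_subset_iff extensional_def Pi_iff)

lemma continuous_map_cube_coordinate:
  "i < l \<Longrightarrow> continuous_map (cube l) euclideanreal (\<lambda>x. x i)"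
  using continuous_map_into_cube[of "cube l" l id] by simp

lemma compact_topspace_cube: "compact (topspace (cube l))"
proof -
  have "topspace (cube l) = PiE UNIV (\<lambda>i. if i < l then {0..1} else {undefined})"
  proof (rule set_eqI)
    show "x \<in> topspace (cube l) \<longleftrightarrow> x \<in> PiE UNIV (\<lambda>i. if i < l then {0..1} else {undefined})" for x
      unfolding topspace_cube PiE_iff extensional_def by (simp add: Ball_def) meson
  qed
  moreover have "compactin (product_topology (\<lambda>i. euclidean :: real topology) UNIV)
      (PiE UNIV (\<lambda>i::nat. if i < l then {0..1} else {undefined}))"
    unfolding compactin_PiE by auto
  ultimately show ?thesis
    by (simp add: euclidean_product_topology)
qed

text \<open>
  Through this map every continuous map on \<open>cube l\<close> becomes a continuous map on a compact metric space,
  to which the Lebesgue number argument applies.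
\<close>
lemma continuous_map_top_of_set_cube: "continuous_map (top_of_set (topspace (cube l))) (cube l) (\<lambda>x. x)"
  unfolding continuous_map_into_cube
  by (auto intro: continuous_on_product_coordinates continuous_on_subset)

text \<open>
  The metric on functions from the naturals is a weighted sum of the truncated coordinate distances, with
  weights \<open>(1/2)^n\<close> of total mass \<open>2\<close>.
\<close>
lemma dist_fun_le:
  fixes x y :: "nat \<Rightarrow> real"
  assumes "\<And>i. dist (x i) (y i) \<le> c"
  shows "dist x y \<le> 2 * c"
proof -
  have s: "summable (\<lambda>n. (1 / 2) ^ n * c :: real)"
    by (intro summable_mult2 summable_geometric) simp
  have "dist x y = (\<Sum>n. (1 / 2) ^ n * min (dist (x (from_nat n)) (y (from_nat n))) 1)"
    by (rule dist_fun_def)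
  also have "\<dots> \<le> (\<Sum>n. (1 / 2) ^ n * c)"
  proof (rule suminf_le)
    show "(1 / 2) ^ n * min (dist (x (from_nat n)) (y (from_nat n))) 1 \<le> (1 / 2) ^ n * c" for n
      using assms[of "from_nat n"] by (intro mult_left_mono) auto
    show "summable (\<lambda>n. (1 / 2) ^ n * min (dist (x (from_nat n)) (y (from_nat n))) 1)"
      by (rule summable_comparison_test'[OF s, of 0])
         (use assms in \<open>auto intro!: mult_left_mono min.coboundedI1 simp: abs_mult\<close>)
  qed (rule s)
  also have "\<dots> = 2 * c"
    by (simp add: suminf_mult2[symmetric] suminf_geometric summable_geometric)
  finally show ?thesis .
qed

section \<open>Compression of a single cube\<close>

abbreviation I01 :: "real topology" where
  "I01 \<equiv> top_of_set {0..1}"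

lemma continuous_map_prod_time: "continuous_map (prod_topology I01 Z) euclideanreal fst"
  using continuous_map_fst[of I01 Z] by (simp add: continuous_map_in_subtopology)

lemma continuous_map_prod_coordinate:
  "i < m \<Longrightarrow> continuous_map (prod_topology I01 (cube m)) euclideanreal (\<lambda>p. snd p i)"
  using continuous_map_compose[OF continuous_map_snd[of I01 "cube m"] continuous_map_cube_coordinate]
  by (simp add: o_def)

lemma continuous_map_Max:
  assumes "finite J" "\<And>i. i \<in> J \<Longrightarrow> continuous_map Z euclideanreal (g i)"
  shows "continuous_map Z euclideanreal (\<lambda>x. Max (insert 0 ((\<lambda>i. g i x) ` J)))"
  using assms
proof (induction J rule: finite_induct)
  case (insert a J)
  have "Max (insert 0 ((\<lambda>i. g i x) ` insert a J)) = max (g a x) (Max (insert 0 ((\<lambda>i. g i x) ` J)))" for x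
    using insert.hyps(1) by (simp add: insert_commute[of 0])
  moreover have "continuous_map Z euclideanreal (\<lambda>x. max (g a x) (Max (insert 0 ((\<lambda>i. g i x) ` J))))"
    using insert by (intro continuous_map_real_max) simp_all
  ultimately show ?case
    by (simp only:)
qed simp

text \<open>
  The distance from the centre of the cube in the sup norm, scaled so that the boundary is the
  sphere of radius \<open>1\<close>. Inserting \<open>0\<close> gives the right value for the \<open>0\<close>-cube.
\<close>
definition sup_radius :: "nat \<Rightarrow> (nat \<Rightarrow> real) \<Rightarrow> real" where
  "sup_radius m y = Max (insert 0 ((\<lambda>i. \<bar>2 * y i - 1\<bar>) ` {..<m}))"

text \<open>
  Scaling by the factor \<open>c\<close> about the centre of the cube.
\<close>
definition dilate :: "nat \<Rightarrow> real \<Rightarrow> (nat \<Rightarrow> real) \<Rightarrow> nat \<Rightarrow> real" where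
  "dilate m c y = (\<lambda>i\<in>{..<m}. (1 + c * (2 * y i - 1)) / 2)"

lemma sup_radius_ge: "i < m \<Longrightarrow> \<bar>2 * y i - 1\<bar> \<le> sup_radius m y"
  and sup_radius_nonneg: "0 \<le> sup_radius m y"
  unfolding sup_radius_def by (auto intro!: Max_ge)

lemma sup_radius_attained:
  assumes "sup_radius m y > 0"
  obtains i where "i < m" "\<bar>2 * y i - 1\<bar> = sup_radius m y"
proof -
  have "sup_radius m y \<in> insert 0 ((\<lambda>i. \<bar>2 * y i - 1\<bar>) ` {..<m})"
    unfolding sup_radius_def by (rule Max_in) auto
  then show thesis
    using assms that by auto
qed

lemma sup_radius_le_1: "y \<in> topspace (cube m) \<Longrightarrow> sup_radius m y \<le> 1"
  unfolding sup_radius_def topspace_cube by (subst Max_le_iff) (auto simp: PiE_iff abs_le_iff)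

lemma sup_radius_boundary:
  assumes "y \<in> cube_boundary m"
  shows "sup_radius m y = 1"
proof -
  obtain i where "i < m" "y i = 0 \<or> y i = 1"
    using assms unfolding cube_boundary_def by blast
  then have "1 \<le> sup_radius m y"
    using sup_radius_ge[of i m y] by auto
  moreover have "sup_radius m y \<le> 1"
    using assms sup_radius_le_1 unfolding cube_boundary_def by blast
  ultimately show ?thesis
    by simp
qed

lemma dilate_1: "y \<in> topspace (cube m) \<Longrightarrow> dilate m 1 y = y"
  unfolding dilate_def topspace_cube by (auto simp: PiE_iff extensional_def)

lemma dilate_in_cube:
  assumes "c \<ge> 0" "c * sup_radius m y \<le> 1"
  shows "dilate m c y \<in> topspace (cube m)"
proof -
  have "\<bar>c * (2 * y i - 1)\<bar> \<le> 1" if "i < m" for i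
    using mult_left_mono[OF sup_radius_ge[OF that, of y] assms(1)] assms by (simp add: abs_mult)
  then show ?thesis
    unfolding dilate_def topspace_cube by (auto simp: abs_le_iff) (smt (verit))+
qed

lemma dilate_in_boundary:
  assumes "c \<ge> 0" "c * sup_radius m y = 1"
  shows "dilate m c y \<in> cube_boundary m"
proof -
  have "sup_radius m y > 0"
    using assms(2) sup_radius_nonneg[of m y] by (metis less_eq_real_def mult_zero_right zero_neq_one)
  then obtain i where i: "i < m" "\<bar>2 * y i - 1\<bar> = sup_radius m y"
    by (rule sup_radius_attained)
  then have "\<bar>c * (2 * y i - 1)\<bar> = 1"
    using assms by (simp add: abs_mult)
  then have "dilate m c y i = 0 \<or> dilate m c y i = 1"
    using i(1) by (auto simp: dilate_def abs_if split: if_splits)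
  then show ?thesis
    using i(1) dilate_in_cube[of c m y] assms unfolding cube_boundary_def by auto
qed

lemma continuous_map_dilate:
  assumes "continuous_map Z euclideanreal c" "\<And>i. i < m \<Longrightarrow> continuous_map Z euclideanreal (\<lambda>p. y p i)"
    and "\<And>p. p \<in> topspace Z \<Longrightarrow> c p \<ge> 0 \<and> c p * sup_radius m (y p) \<le> 1"
  shows "continuous_map Z (cube m) (\<lambda>p. dilate m (c p) (y p))"
  unfolding continuous_map_into_cube
proof (intro conjI allI impI)
  show "(\<lambda>p. dilate m (c p) (y p)) ` topspace Z \<subseteq> topspace (cube m)"
    using assms(3) dilate_in_cube by blast
  show "continuous_map Z euclideanreal (\<lambda>p. dilate m (c p) (y p) i)" if "i < m" for i
    using that assms(1,2)
    by (simp add: dilate_def) (intro continuous_intros continuous_map_real_divide; simp)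
qed

text \<open>
  The pair formed by the cube and its boundary has the homotopy extension property. At time \<open>t\<close> the
  concentric cube of radius \<open>1 - t / 2\<close> carries a rescaled copy of \<open>f\<close>, and the remaining collar
  carries the track of \<open>\<phi>\<close>: a point of radius \<open>s\<close> in the collar is projected radially to the boundary
  and sees \<open>\<phi>\<close> at time \<open>2 - (2 - t) / s\<close>, which grows from \<open>0\<close> at the inner cube to \<open>t\<close> at the boundary.
  This is composition with the radial retraction of the cylinder, from a point above the centre
  at height \<open>2\<close>, onto its bottom and sides.
\<close>
lemma cube_homotopy_extension:
  assumes f: "continuous_map (cube m) T f"
    and \<phi>: "continuous_map (prod_topology I01 (subtopology (cube m) (cube_boundary m))) T \<phi>"
    and \<phi>0: "\<And>y. y \<in> cube_boundary m \<Longrightarrow> \<phi> (0, y) = f y"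
  obtains G where "continuous_map (prod_topology I01 (cube m)) T G"
    "\<And>y. y \<in> topspace (cube m) \<Longrightarrow> G (0, y) = f y"
    "\<And>t y. \<lbrakk>t \<in> {0..1}; y \<in> cube_boundary m\<rbrakk> \<Longrightarrow> G (t, y) = \<phi> (t, y)"
proof -
  define D where "D = prod_topology I01 (cube m)"
  define s where "s = (\<lambda>p::real \<times> (nat \<Rightarrow> real). sup_radius m (snd p))"
  define inner where "inner = (\<lambda>p. f (dilate m (2 / (2 - fst p)) (snd p)))"
  define outer where "outer = (\<lambda>p. \<phi> (2 - (2 - fst p) / s p, dilate m (1 / s p) (snd p)))"
  define G where "G = (\<lambda>p. if s p \<le> 1 - fst p / 2 then inner p else outer p)"
  have time: "fst p \<in> {0..1}" and point: "snd p \<in> topspace (cube m)" if "p \<in> topspace D" for p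
    using that unfolding D_def by auto
  have cont_time: "continuous_map D euclideanreal fst"
    unfolding D_def by (rule continuous_map_prod_time)
  have cont_coord: "continuous_map D euclideanreal (\<lambda>p. snd p i)" if "i < m" for i
    unfolding D_def using that by (rule continuous_map_prod_coordinate)
  have cont_s: "continuous_map D euclideanreal s"
    unfolding s_def sup_radius_def
    by (rule continuous_map_Max) (auto intro!: continuous_intros continuous_map_real_mult_left cont_coord)
  have cont_bound: "continuous_map D euclideanreal (\<lambda>p. 1 - fst p / 2)"
    by (intro continuous_intros continuous_map_real_divide cont_time) auto
  let ?A = "{p \<in> topspace D. s p \<le> 1 - fst p / 2}"
  let ?B = "{p \<in> topspace D. 1 - fst p / 2 \<le> s p}"
  have "continuous_map (subtopology D ?A) (cube m) (\<lambda>p. dilate m (2 / (2 - fst p)) (snd p))"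
  proof (rule continuous_map_dilate)
    show "continuous_map (subtopology D ?A) euclideanreal (\<lambda>p. 2 / (2 - fst p))"
      by (rule continuous_map_from_subtopology)
         (intro continuous_intros continuous_map_real_divide cont_time; use time in force)
    show "0 \<le> 2 / (2 - fst p) \<and> 2 / (2 - fst p) * sup_radius m (snd p) \<le> 1"
      if "p \<in> topspace (subtopology D ?A)" for p
      using that time[of p] by (auto simp: s_def field_simps)
  qed (intro continuous_map_from_subtopology cont_coord)
  from continuous_map_compose[OF this f]
  have cont_inner: "continuous_map (subtopology D ?A) T inner"
    by (simp add: inner_def o_def)
  \<comment> \<open>In the collar the radius is bounded away from \<open>0\<close>, so dividing by it is continuous.\<close>
  have B: "s p \<ge> 1 / 2" "s p \<le> 1" "1 - fst p / 2 \<le> s p" "p \<in> topspace D" if "p \<in> topspace (subtopology D ?B)" for p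
    using that time[of p] sup_radius_le_1[OF point[of p]] by (auto simp: s_def)
  have inv_s: "continuous_map (subtopology D ?B) euclideanreal (\<lambda>p. 1 / s p)"
    by (intro continuous_map_real_divide continuous_map_from_subtopology cont_s) (use B(1) in force)+
  have "continuous_map (subtopology D ?B) (cube m) (\<lambda>p. dilate m (1 / s p) (snd p))"
  proof (rule continuous_map_dilate[OF inv_s])
    show "0 \<le> 1 / s p \<and> 1 / s p * sup_radius m (snd p) \<le> 1"
      if "p \<in> topspace (subtopology D ?B)" for p
      using B(1)[OF that] by (simp add: s_def)
  qed (intro continuous_map_from_subtopology cont_coord)
  moreover have "dilate m (1 / s p) (snd p) \<in> cube_boundary m" if "p \<in> topspace (subtopology D ?B)" for p
    using B(1)[OF that] by (intro dilate_in_boundary) (simp_all add: s_def)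
  ultimately have "continuous_map (subtopology D ?B) (subtopology (cube m) (cube_boundary m))
      (\<lambda>p. dilate m (1 / s p) (snd p))"
    unfolding continuous_map_in_subtopology by blast
  moreover have "continuous_map (subtopology D ?B) I01 (\<lambda>p. 2 - (2 - fst p) / s p)"
    unfolding continuous_map_in_subtopology
  proof
    show "continuous_map (subtopology D ?B) euclideanreal (\<lambda>p. 2 - (2 - fst p) / s p)"
      by (intro continuous_intros continuous_map_real_divide continuous_map_from_subtopology cont_s cont_time)
         (use B(1) in force)+
    show "(\<lambda>p. 2 - (2 - fst p) / s p) \<in> topspace (subtopology D ?B) \<rightarrow> {0..1}"
    proof
      fix p assume p: "p \<in> topspace (subtopology D ?B)"
      have "fst p \<le> 1"
        using time[OF B(4)[OF p]] by simp
      then show "2 - (2 - fst p) / s p \<in> {0..1}"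
        using B(1-3)[OF p] by (simp add: field_simps)
    qed
  qed
  ultimately have "continuous_map (subtopology D ?B) (prod_topology I01 (subtopology (cube m) (cube_boundary m)))
      (\<lambda>p. (2 - (2 - fst p) / s p, dilate m (1 / s p) (snd p)))"
    by (simp add: continuous_map_pairwise o_def)
  from continuous_map_compose[OF this \<phi>]
  have cont_outer: "continuous_map (subtopology D ?B) T outer"
    by (simp add: outer_def o_def)
  have agree: "inner p = outer p" if p: "p \<in> topspace D" "s p = 1 - fst p / 2" for p
  proof -
    have s: "s p > 0" "2 - fst p = 2 * s p"
      using time[OF p(1)] p(2) by auto
    then have "outer p = \<phi> (0, dilate m (1 / s p) (snd p))"
      by (simp add: outer_def)
    also have "\<dots> = f (dilate m (1 / s p) (snd p))"
      using s(1) by (intro \<phi>0 dilate_in_boundary) (simp_all add: s_def)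
    also have "1 / s p = 2 / (2 - fst p)"
      using s by simp
    finally show ?thesis
      by (simp add: inner_def)
  qed
  show thesis
  proof (rule that)
    show "continuous_map (prod_topology I01 (cube m)) T G"
      unfolding G_def D_def[symmetric]
      by (rule continuous_map_cases_le[OF cont_s cont_bound cont_inner cont_outer agree])
    show "G (0, y) = f y" if "y \<in> topspace (cube m)" for y
      using that sup_radius_le_1[OF that] by (simp add: G_def inner_def s_def dilate_1)
    show "G (t, y) = \<phi> (t, y)" if t: "t \<in> {0..1}" and y: "y \<in> cube_boundary m" for t y
    proof -
      have "y \<in> topspace (cube m)"
        using y by (simp add: cube_boundary_def)
      then have "outer (t, y) = \<phi> (t, y)" "t = 0 \<Longrightarrow> inner (t, y) = \<phi> (t, y)"
        using \<phi>0[OF y] sup_radius_boundary[OF y] by (simp_all add: outer_def inner_def s_def dilate_1)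
      then show ?thesis
        using t sup_radius_boundary[OF y] by (auto simp: G_def s_def)
    qed
  qed
qed

lemma k_connected_pair_path:
  assumes "k_connected_pair k T V" "x \<in> topspace T"
  obtains p where "pathin T p" "p 0 = x" "p 1 \<in> V"
  using assms unfolding k_connected_pair_def by blast

lemma k_connected_pair_homotopy:
  assumes "k_connected_pair k T V" "1 \<le> m" "m \<le> k" "continuous_map (cube m) T h" "h ` cube_boundary m \<subseteq> V"
  obtains K where "continuous_map (prod_topology I01 (cube m)) T K" "\<And>y. K (0, y) = h y"
    "\<And>y. y \<in> topspace (cube m) \<Longrightarrow> K (1, y) \<in> V"
    "\<And>t y. \<lbrakk>t \<in> {0..1}; y \<in> cube_boundary m\<rbrakk> \<Longrightarrow> K (t, y) = h y"
proof -
  obtain g where "homotopic_with (\<lambda>h'. \<forall>x\<in>cube_boundary m. h' x = h x) (cube m) T h g"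
    and g: "g ` topspace (cube m) \<subseteq> V"
    using assms unfolding k_connected_pair_def by blast
  then obtain K where K: "continuous_map (prod_topology I01 (cube m)) T K"
    "\<forall>y. K (0, y) = h y" "\<forall>y. K (1, y) = g y" "\<forall>t\<in>{0..1}. \<forall>y\<in>cube_boundary m. K (t, y) = h y"
    unfolding homotopic_with_def by blast
  show thesis
    by (rule that[of K]) (use K g in auto)
qed

text \<open>
  The homotopy \<open>\<phi>\<close> is extended over the cube during the first half of the time; its end map has its
  boundary in \<open>V\<close>, and the second half compresses it into \<open>V\<close> relative to the boundary. On the
  boundary this runs \<open>\<phi>\<close> at double speed and then stops, which explains the time
  \<open>min (2 * t) 1\<close>. For \<open>m = 0\<close> the boundary is empty and the compression is a path, which is the
  separate clause of \<open>k\<close>-connectedness about points.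
\<close>
lemma cube_compression:
  assumes conn: "k_connected_pair k T V" and "m \<le> k"
    and f: "continuous_map (cube m) T f"
    and \<phi>: "continuous_map (prod_topology I01 (subtopology (cube m) (cube_boundary m))) T \<phi>"
    and \<phi>0: "\<And>y. y \<in> cube_boundary m \<Longrightarrow> \<phi> (0, y) = f y"
    and \<phi>1: "\<And>y. y \<in> cube_boundary m \<Longrightarrow> \<phi> (1, y) \<in> V"
  obtains F where "continuous_map (prod_topology I01 (cube m)) T F"
    "\<And>y. y \<in> topspace (cube m) \<Longrightarrow> F (0, y) = f y"
    "\<And>y. y \<in> topspace (cube m) \<Longrightarrow> F (1, y) \<in> V"
    "\<And>t y. \<lbrakk>t \<in> {0..1}; y \<in> cube_boundary m\<rbrakk> \<Longrightarrow> F (t, y) = \<phi> (min (2 * t) 1, y)"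
proof (cases "m = 0")
  case True
  have y: "y = (\<lambda>_. undefined)" if "y \<in> topspace (cube m)" for y
    using that True by (simp add: topspace_cube)
  have "f (\<lambda>_. undefined) \<in> topspace T"
    using f True by (auto simp: topspace_cube continuous_map_def)
  then obtain p where p: "pathin T p" "p 0 = f (\<lambda>_. undefined)" "p 1 \<in> V"
    using k_connected_pair_path[OF conn] by blast
  show thesis
  proof (rule that[of "p \<circ> fst"])
    show "continuous_map (prod_topology I01 (cube m)) T (p \<circ> fst)"
      using p(1) continuous_map_fst unfolding pathin_def by (rule continuous_map_compose[rotated])
  qed (use p y True in \<open>auto simp: cube_boundary_def\<close>)
next
  case False
  obtain G where G: "continuous_map (prod_topology I01 (cube m)) T G"
    and G0: "\<And>y. y \<in> topspace (cube m) \<Longrightarrow> G (0, y) = f y"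
    and Gb: "\<And>t y. \<lbrakk>t \<in> {0..1}; y \<in> cube_boundary m\<rbrakk> \<Longrightarrow> G (t, y) = \<phi> (t, y)"
    using cube_homotopy_extension[OF f \<phi> \<phi>0] by blast
  define h where "h = (\<lambda>y. G (1, y))"
  have "continuous_map (cube m) (prod_topology I01 (cube m)) (\<lambda>y. (1, y))"
    by (simp add: continuous_map_pairwise o_def)
  from continuous_map_compose[OF this G] have "continuous_map (cube m) T h"
    by (simp add: h_def o_def)
  moreover have "h ` cube_boundary m \<subseteq> V"
    using \<phi>1 Gb by (auto simp: h_def)
  ultimately obtain K where K: "continuous_map (prod_topology I01 (cube m)) T K"
    and K0: "\<And>y. K (0, y) = h y" and K1: "\<And>y. y \<in> topspace (cube m) \<Longrightarrow> K (1, y) \<in> V"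
    and Kb: "\<And>t y. \<lbrakk>t \<in> {0..1}; y \<in> cube_boundary m\<rbrakk> \<Longrightarrow> K (t, y) = h y"
    using k_connected_pair_homotopy[OF conn _ \<open>m \<le> k\<close>] False by (metis One_nat_def Suc_leI neq0_conv)
  define D where "D = prod_topology I01 (cube m)"
  define F where "F = (\<lambda>p. if fst p \<le> 1 / 2 then G (2 * fst p, snd p) else K (2 * fst p - 1, snd p))"
  have time: "continuous_map D euclideanreal fst"
    unfolding D_def by (rule continuous_map_prod_time)
  have snd: "continuous_map D (cube m) snd"
    unfolding D_def by (rule continuous_map_snd)
  have "continuous_map (subtopology D S) D (\<lambda>p. (a * fst p + b, snd p))"
    if "\<And>p. p \<in> topspace D \<Longrightarrow> p \<in> S \<Longrightarrow> a * fst p + b \<in> {0..1}" for a b S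
  proof -
    have "continuous_map (subtopology D S) I01 (\<lambda>p. a * fst p + b)"
      unfolding continuous_map_in_subtopology
      using that by (auto intro!: continuous_intros continuous_map_real_mult_left continuous_map_from_subtopology time)
    then show ?thesis
      using continuous_map_from_subtopology[OF snd, of S]
      unfolding D_def by (simp add: continuous_map_pairwise o_def)
  qed note rescale = this
  have time01: "fst p \<in> {0..1}" if "p \<in> topspace D" for p
    using that unfolding D_def by auto
  have "continuous_map D T F"
    unfolding F_def
  proof (rule continuous_map_cases_le[OF time])
    show "continuous_map D euclideanreal (\<lambda>p. 1 / 2)"
      by simp
    have "continuous_map (subtopology D {p \<in> topspace D. fst p \<le> 1 / 2}) D (\<lambda>p. (2 * fst p + 0, snd p))"
      by (rule rescale) (use time01 in auto)
    from continuous_map_compose[OF this G[folded D_def]]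
    show "continuous_map (subtopology D {p \<in> topspace D. fst p \<le> 1 / 2}) T (\<lambda>p. G (2 * fst p, snd p))"
      by (simp add: o_def)
    have "continuous_map (subtopology D {p \<in> topspace D. 1 / 2 \<le> fst p}) D (\<lambda>p. (2 * fst p + - 1, snd p))"
      by (rule rescale) (use time01 in auto)
    from continuous_map_compose[OF this K[folded D_def]]
    show "continuous_map (subtopology D {p \<in> topspace D. 1 / 2 \<le> fst p}) T (\<lambda>p. K (2 * fst p - 1, snd p))"
      by (simp add: o_def)
    show "G (2 * fst p, snd p) = K (2 * fst p - 1, snd p)" if "fst p = 1 / 2" for p
    proof -
      have "2 * fst p = 1" "2 * fst p - 1 = 0"
        using that by simp_all
      then show ?thesis
        using K0 by (simp only: h_def)
    qed
  qed
  then show thesis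
  proof (intro that[of F])
    show "F (t, y) = \<phi> (min (2 * t) 1, y)" if "t \<in> {0..1}" "y \<in> cube_boundary m" for t y
      using that Gb[of "2 * t" y] Gb[of 1 y] Kb[of "2 * t - 1" y] by (auto simp: F_def h_def min_def)
  qed (use G0 K1 in \<open>auto simp: F_def D_def\<close>)
qed

section \<open>Cells of the cubical grid\<close>

text \<open>
  The closed cell of the grid of mesh \<open>1 / N\<close> that has \<open>x\<close> in its relative interior. Naming a cell by
  an interior point removes the bookkeeping of corners and directions: a coordinate of \<open>x\<close> on
  the grid has equal floor and ceiling and is fixed in the cell, the others range over an
  interval of length \<open>1 / N\<close>.
\<close>
definition cell :: "nat \<Rightarrow> nat \<Rightarrow> (nat \<Rightarrow> real) \<Rightarrow> (nat \<Rightarrow> real) set" where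
  "cell l N x = {y \<in> topspace (cube l).
     \<forall>i<l. of_int \<lfloor>real N * x i\<rfloor> \<le> real N * y i \<and> real N * y i \<le> of_int \<lceil>real N * x i\<rceil>}"

definition free_coords :: "nat \<Rightarrow> nat \<Rightarrow> (nat \<Rightarrow> real) \<Rightarrow> nat set" where
  "free_coords l N x = {i. i < l \<and> real N * x i \<notin> \<int>}"

definition cell_dim :: "nat \<Rightarrow> nat \<Rightarrow> (nat \<Rightarrow> real) \<Rightarrow> nat" where
  "cell_dim l N x = card (free_coords l N x)"

definition cell_rim :: "nat \<Rightarrow> nat \<Rightarrow> (nat \<Rightarrow> real) \<Rightarrow> (nat \<Rightarrow> real) set" where
  "cell_rim l N x = {y \<in> cell l N x. cell_dim l N y < cell_dim l N x}"

lemma cell_subset_cube: "cell l N x \<subseteq> topspace (cube l)"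
  unfolding cell_def by blast

lemma cell_rim_subset_cell: "cell_rim l N x \<subseteq> cell l N x"
  unfolding cell_rim_def by blast

lemma mem_own_cell: "x \<in> topspace (cube l) \<Longrightarrow> x \<in> cell l N x"
  unfolding cell_def by simp

lemma finite_free_coords: "finite (free_coords l N x)"
  unfolding free_coords_def by simp

lemma cell_dim_le: "cell_dim l N x \<le> l"
  using card_mono[of "{..<l}" "free_coords l N x"] unfolding cell_dim_def free_coords_def by auto

text \<open>
  Floors and ceilings are monotone, so the cell of a point of a cell is a face of that cell.
\<close>
lemma cell_subset_cell:
  assumes "y \<in> cell l N x"
  shows "cell l N y \<subseteq> cell l N x"
proof
  fix z assume z: "z \<in> cell l N y"
  have "of_int \<lfloor>real N * x i\<rfloor> \<le> real N * z i \<and> real N * z i \<le> of_int \<lceil>real N * x i\<rceil>" if "i < l" for i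
  proof -
    have "\<lfloor>real N * x i\<rfloor> \<le> \<lfloor>real N * y i\<rfloor>" "\<lceil>real N * y i\<rceil> \<le> \<lceil>real N * x i\<rceil>"
      using assms that unfolding cell_def by (auto simp: le_floor_iff ceiling_le_iff)
    moreover have "of_int \<lfloor>real N * y i\<rfloor> \<le> real N * z i" "real N * z i \<le> of_int \<lceil>real N * y i\<rceil>"
      using z that unfolding cell_def by auto
    ultimately show ?thesis
      by (meson of_int_le_iff order_trans)
  qed
  then show "z \<in> cell l N x"
    using z unfolding cell_def by blast
qed

lemma free_coords_mono:
  assumes "y \<in> cell l N x"
  shows "free_coords l N y \<subseteq> free_coords l N x"
proof
  fix i assume i: "i \<in> free_coords l N y"
  have "real N * y i \<in> \<int>" if int: "real N * x i \<in> \<int>"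
  proof -
    obtain z where "real N * x i = of_int z"
      using int by (rule Ints_cases)
    then have "real N * y i = of_int z"
      using assms i unfolding cell_def free_coords_def by auto
    then show ?thesis
      by simp
  qed
  then show "i \<in> free_coords l N x"
    using i unfolding free_coords_def by auto
qed

lemma cell_dim_mono: "y \<in> cell l N x \<Longrightarrow> cell_dim l N y \<le> cell_dim l N x"
  unfolding cell_dim_def by (intro card_mono finite_free_coords free_coords_mono)

lemma floor_ceiling_eq_if_between:
  fixes a b :: real
  assumes "of_int \<lfloor>a\<rfloor> \<le> b" "b \<le> of_int \<lceil>a\<rceil>" "b \<notin> \<int>"
  shows "\<lfloor>b\<rfloor> = \<lfloor>a\<rfloor>" "\<lceil>b\<rceil> = \<lceil>a\<rceil>"
proof -
  have ne: "of_int \<lfloor>a\<rfloor> \<noteq> b" "of_int \<lceil>a\<rceil> \<noteq> b"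
    using assms(3) by auto
  have "\<lceil>a\<rceil> \<le> \<lfloor>a\<rfloor> + 1"
    by linarith
  then show "\<lfloor>b\<rfloor> = \<lfloor>a\<rfloor>" "\<lceil>b\<rceil> = \<lceil>a\<rceil>"
    using assms(1,2) ne by linarith+
qed

text \<open>
  A face of full dimension is the whole cell. For pasting this means that distinct cells of equal
  dimension meet only in their rims.
\<close>
lemma cell_eq_if_dim_eq:
  assumes y: "y \<in> cell l N x" and dim: "cell_dim l N y = cell_dim l N x"
  shows "cell l N y = cell l N x"
proof -
  have free: "free_coords l N y = free_coords l N x"
    using card_subset_eq[OF finite_free_coords free_coords_mono[OF y]] dim unfolding cell_dim_def by blast
  have "\<lfloor>real N * y i\<rfloor> = \<lfloor>real N * x i\<rfloor> \<and> \<lceil>real N * y i\<rceil> = \<lceil>real N * x i\<rceil>" if i: "i < l" for i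
  proof (cases "real N * y i \<in> \<int>")
    case False
    then show ?thesis
      using y i floor_ceiling_eq_if_between[of "real N * x i" "real N * y i"] unfolding cell_def by auto
  next
    case True
    then have "real N * x i \<in> \<int>"
      using free i unfolding free_coords_def by blast
    then obtain z where "real N * x i = of_int z"
      by (rule Ints_cases)
    moreover from this have "real N * y i = of_int z"
      using y i unfolding cell_def by auto
    ultimately show ?thesis
      by simp
  qed
  then show ?thesis
    unfolding cell_def by auto
qed

lemma closedin_cell: "closedin (cube l) (cell l N x)"
proof -
  have "closedin (cube l) {y \<in> topspace (cube l). \<forall>i\<in>J. real N * y i \<in> {of_int \<lfloor>real N * x i\<rfloor>..of_int \<lceil>real N * x i\<rceil>}}"
    if "finite J" "J \<subseteq> {..<l}" for J
    using that
  proof (induction J rule: finite_induct)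
    case (insert i J)
    have "continuous_map (cube l) euclideanreal (\<lambda>y. real N * y i)"
      using insert.prems by (intro continuous_map_real_mult_left continuous_map_cube_coordinate) simp
    then have "closedin (cube l) {y \<in> topspace (cube l). real N * y i \<in> {of_int \<lfloor>real N * x i\<rfloor>..of_int \<lceil>real N * x i\<rceil>}}"
      by (rule closedin_continuous_map_preimage) simp
    moreover have "closedin (cube l) {y \<in> topspace (cube l). \<forall>i\<in>J. real N * y i \<in> {of_int \<lfloor>real N * x i\<rfloor>..of_int \<lceil>real N * x i\<rceil>}}"
      using insert by simp
    ultimately have "closedin (cube l) ({y \<in> topspace (cube l). real N * y i \<in> {of_int \<lfloor>real N * x i\<rfloor>..of_int \<lceil>real N * x i\<rceil>}} \<inter>
       {y \<in> topspace (cube l). \<forall>i\<in>J. real N * y i \<in> {of_int \<lfloor>real N * x i\<rfloor>..of_int \<lceil>real N * x i\<rceil>}})"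
      by (rule closedin_Int)
    then show ?case
      by (rule back_subst) blast
  qed simp
  from this[of "{..<l}"] show ?thesis
    unfolding cell_def by (simp add: Ball_def)
qed

text \<open>
  A cell is determined by the floors and ceilings of the scaled coordinates, which are integers
  between \<open>0\<close> and \<open>N\<close>.
\<close>
lemma finite_cells: "finite (cell l N ` topspace (cube l))"
proof -
  define B where "B = PiE {..<l} (\<lambda>_. {0..int N})"
  define C where "C = (\<lambda>(a, b). {y \<in> topspace (cube l). \<forall>i<l. of_int (a i) \<le> real N * y i \<and> real N * y i \<le> of_int (b i)})"
  have "cell l N x \<in> C ` (B \<times> B)" if x: "x \<in> topspace (cube l)" for x
  proof -
    have "0 \<le> real N * x i \<and> real N * x i \<le> real N" if "i < l" for i
      using x that by (auto simp: topspace_cube PiE_iff mult_left_le)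
    then have "(\<lambda>i\<in>{..<l}. \<lfloor>real N * x i\<rfloor>, \<lambda>i\<in>{..<l}. \<lceil>real N * x i\<rceil>) \<in> B \<times> B"
      unfolding B_def by (force simp: le_floor_iff floor_le_iff ceiling_le_iff le_ceiling_iff)
    moreover have "cell l N x = C (\<lambda>i\<in>{..<l}. \<lfloor>real N * x i\<rfloor>, \<lambda>i\<in>{..<l}. \<lceil>real N * x i\<rceil>)"
      unfolding cell_def C_def by simp
    ultimately show ?thesis
      by blast
  qed
  then have "cell l N ` topspace (cube l) \<subseteq> C ` (B \<times> B)"
    by blast
  moreover have "finite (C ` (B \<times> B))"
    unfolding B_def by (intro finite_imageI finite_cartesian_product finite_PiE) auto
  ultimately show ?thesis
    by (rule finite_subset)
qed

lemma diameter_cell_le: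
  assumes "N > 0"
  shows "diameter (cell l N x) \<le> 2 / real N"
proof -
  have "dist y z \<le> 2 / real N" if yz: "y \<in> cell l N x" "z \<in> cell l N x" for y z
  proof -
    have "dist (y i) (z i) \<le> 1 / real N" for i
    proof (cases "i < l")
      case True
      have "of_int \<lceil>real N * x i\<rceil> \<le> (of_int \<lfloor>real N * x i\<rfloor> + 1 :: real)"
        using ceiling_diff_floor_le_1[of "real N * x i"] by linarith
      then have "\<bar>real N * y i - real N * z i\<bar> \<le> 1"
        using yz True unfolding cell_def by (auto simp: abs_le_iff) (smt (verit))+
      then have "real N * \<bar>y i - z i\<bar> \<le> 1"
        by (simp flip: right_diff_distrib add: abs_mult)
      then show ?thesis
        using assms by (simp add: dist_real_def field_simps)
    next
      case False
      then have "y i = z i"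
        using yz unfolding cell_def topspace_cube by (auto simp: PiE_iff extensional_def)
      then show ?thesis
        by simp
    qed
    from dist_fun_le[of y z, OF this] show ?thesis
      by simp
  qed
  then show ?thesis
    unfolding diameter_def by (auto intro!: cSUP_least)
qed

text \<open>
  A boundary point has a coordinate \<open>0\<close> or \<open>1\<close>; both are grid values, so this coordinate is fixed
  throughout the cell.
\<close>
lemma cell_boundary_point_subset:
  assumes y: "y \<in> cube_boundary l" and "N > 0"
  shows "cell l N y \<subseteq> cube_boundary l"
proof
  fix z assume z: "z \<in> cell l N y"
  obtain i where i: "i < l" "y i = 0 \<or> y i = 1"
    using y unfolding cube_boundary_def by blast
  have "real N * z i = real N * y i"
    using z i unfolding cell_def by force
  then show "z \<in> cube_boundary l"
    using \<open>N > 0\<close> i z unfolding cell_def cube_boundary_def by auto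
qed

section \<open>Compression of a single cell\<close>

lemma floor_scaled_bounds:
  assumes x: "x \<in> topspace (cube l)" and i: "i \<in> free_coords l N x"
  shows "\<lceil>real N * x i\<rceil> = \<lfloor>real N * x i\<rfloor> + 1" "0 \<le> \<lfloor>real N * x i\<rfloor>" "\<lfloor>real N * x i\<rfloor> + 1 \<le> int N"
proof -
  have x01: "0 \<le> x i" "x i \<le> 1"
    using x i unfolding topspace_cube free_coords_def by (auto simp: PiE_iff)
  show ceil: "\<lceil>real N * x i\<rceil> = \<lfloor>real N * x i\<rfloor> + 1"
    using i unfolding free_coords_def by (metis (mono_tags, lifting) Ints_of_int ceiling_altdef mem_Collect_eq)
  show "0 \<le> \<lfloor>real N * x i\<rfloor>"
    using x01 by simp
  have "\<lceil>real N * x i\<rceil> \<le> int N"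
    using x01 by (simp add: ceiling_le_iff mult_left_le)
  then show "\<lfloor>real N * x i\<rfloor> + 1 \<le> int N"
    using ceil by simp
qed

text \<open>
  Enumerating the free coordinates identifies the cell with a cube of its dimension, by the affine
  map on each free coordinate. Under this identification the rim corresponds to the boundary: a point has lower
  dimension exactly if one of its free coordinates has reached an end of its interval.
\<close>
lemma cell_parametrization:
  assumes x: "x \<in> topspace (cube l)" and "N > 0"
  obtains up down where
    "continuous_map (cube (cell_dim l N x)) (subtopology (cube l) (cell l N x)) up"
    "continuous_map (subtopology (cube l) (cell l N x)) (cube (cell_dim l N x)) down"
    "\<And>y. y \<in> cell l N x \<Longrightarrow> up (down y) = y"
    "up ` cube_boundary (cell_dim l N x) \<subseteq> cell_rim l N x"
    "down ` cell_rim l N x \<subseteq> cube_boundary (cell_dim l N x)"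
proof -
  define m where "m = cell_dim l N x"
  define J where "J = free_coords l N x"
  define a where "a = (\<lambda>i. real_of_int \<lfloor>real N * x i\<rfloor>)"
  have N: "real N > 0"
    using \<open>N > 0\<close> by simp
  have Jl: "i < l" if "i \<in> J" for i
    using that unfolding J_def free_coords_def by simp
  have ceil: "of_int \<lceil>real N * x i\<rceil> = a i + 1" and a0: "0 \<le> a i" and aN: "a i + 1 \<le> real N" if "i \<in> J" for i
    using floor_scaled_bounds[OF x, of i N] that unfolding J_def a_def by linarith+
  have fixed: "real N * y i = real N * x i" if "y \<in> cell l N x" "i < l" "i \<notin> J" for y i
  proof -
    have "real N * x i \<in> \<int>"
      using that unfolding J_def free_coords_def by blast
    then obtain z where "real N * x i = of_int z"
      by (rule Ints_cases)
    then show ?thesis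
      using that unfolding cell_def by auto
  qed
  have between: "a i \<le> real N * y i" "real N * y i \<le> a i + 1" if "y \<in> cell l N x" "i \<in> J" for y i
    using that ceil[OF that(2)] Jl[OF that(2)] unfolding cell_def a_def by auto
  have m: "m = card J" and finJ: "finite J"
    unfolding m_def J_def cell_dim_def by (simp_all add: finite_free_coords)
  obtain e where e: "bij_betw e {..<m} J"
    using ex_bij_betw_nat_finite[OF finJ] unfolding m atLeast0LessThan by blast
  define e' where "e' = inv_into {..<m} e"
  have eJ: "e j \<in> J" "e' (e j) = j" if "j < m" for j
    using e that unfolding e'_def by (auto simp: bij_betw_def inv_into_f_f)
  have e'm: "e' i < m" "e (e' i) = i" if "i \<in> J" for i
    using e that unfolding e'_def by (auto simp: bij_betw_def f_inv_into_f)
  define up where "up = (\<lambda>u::nat \<Rightarrow> real. \<lambda>i\<in>{..<l}. if i \<in> J then (a i + u (e' i)) / real N else x i)"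
  define down where "down = (\<lambda>y::nat \<Rightarrow> real. \<lambda>j\<in>{..<m}. real N * y (e j) - a (e j))"
  have up_free: "real N * up u i = a i + u (e' i)" if "i \<in> J" for u i
    using that Jl[OF that] N by (simp add: up_def)
  have up_cell: "up u \<in> cell l N x" if u: "u \<in> topspace (cube m)" for u
  proof -
    have u01: "0 \<le> u (e' i)" "u (e' i) \<le> 1" if "i \<in> J" for i
      using u e'm(1)[OF that] unfolding topspace_cube by (auto simp: PiE_iff)
    have "up u i \<in> {0..1}" if "i < l" for i
    proof (cases "i \<in> J")
      case True
      then have "0 \<le> a i + u (e' i)" "a i + u (e' i) \<le> real N"
        using u01[OF True] a0[OF True] aN[OF True] by linarith+
      then show ?thesis
        using True that N by (simp add: up_def)
    next
      case False
      then show ?thesis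
        using x that unfolding topspace_cube by (auto simp: up_def PiE_iff)
    qed
    then have "up u \<in> topspace (cube l)"
      unfolding topspace_cube PiE_iff by (simp add: up_def)
    moreover have "of_int \<lfloor>real N * x i\<rfloor> \<le> real N * up u i \<and> real N * up u i \<le> of_int \<lceil>real N * x i\<rceil>"
      if "i < l" for i
    proof (cases "i \<in> J")
      case True
      then show ?thesis
        using u01[OF True] ceil[OF True] up_free[OF True] by (simp add: a_def)
    next
      case False
      then show ?thesis
        using that by (simp add: up_def)
    qed
    ultimately show ?thesis
      unfolding cell_def by blast
  qed
  have down_cube: "down y \<in> topspace (cube m)" if y: "y \<in> cell l N x" for y
  proof -
    have "real N * y (e j) - a (e j) \<in> {0..1}" if "j < m" for j
      using between[OF y eJ(1)[OF that]] by simp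
    then show ?thesis
      unfolding topspace_cube by (simp add: down_def)
  qed
  show thesis
  proof (rule that[folded m_def])
    show "continuous_map (cube m) (subtopology (cube l) (cell l N x)) up"
      unfolding continuous_map_in_subtopology continuous_map_into_cube
    proof (intro conjI allI impI)
      show "up ` topspace (cube m) \<subseteq> topspace (cube l)"
        using up_cell cell_subset_cube by blast
      show "up \<in> topspace (cube m) \<rightarrow> cell l N x"
        using up_cell by blast
      show "continuous_map (cube m) euclideanreal (\<lambda>u. up u i)" if "i < l" for i
      proof (cases "i \<in> J")
        case True
        have "continuous_map (cube m) euclideanreal (\<lambda>u. (a i + u (e' i)) / real N)"
          using N e'm(1)[OF True] by (intro continuous_intros continuous_map_real_divide continuous_map_cube_coordinate) auto
        then show ?thesis
          using True that by (simp add: up_def)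
      qed (use that in \<open>simp add: up_def\<close>)
    qed
    show "continuous_map (subtopology (cube l) (cell l N x)) (cube m) down"
      unfolding continuous_map_into_cube
    proof (intro conjI allI impI)
      show "down ` topspace (subtopology (cube l) (cell l N x)) \<subseteq> topspace (cube m)"
        using down_cube by auto
      show "continuous_map (subtopology (cube l) (cell l N x)) euclideanreal (\<lambda>y. down y j)" if "j < m" for j
      proof -
        have "continuous_map (cube l) euclideanreal (\<lambda>y. real N * y (e j) - a (e j))"
          using Jl[OF eJ(1)[OF that]]
          by (intro continuous_intros continuous_map_real_mult_left continuous_map_cube_coordinate) auto
        then show ?thesis
          using that by (simp add: down_def continuous_map_from_subtopology)
      qed
    qed
    show "up (down y) = y" if y: "y \<in> cell l N x" for y
    proof
      fix i
      have "up (down y) i = y i" if "i < l"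
      proof (cases "i \<in> J")
        case True
        then show ?thesis
          using that e'm[OF True] N by (simp add: up_def down_def)
      next
        case False
        then show ?thesis
          using that fixed[OF y that False] N by (simp add: up_def)
      qed
      moreover have "up (down y) i = y i" if "\<not> i < l"
        using that y unfolding cell_def topspace_cube by (auto simp: up_def PiE_iff extensional_def)
      ultimately show "up (down y) i = y i"
        by blast
    qed
    show "up ` cube_boundary m \<subseteq> cell_rim l N x"
    proof
      fix y assume "y \<in> up ` cube_boundary m"
      then obtain u j where u: "y = up u" "u \<in> topspace (cube m)" "j < m" "u j = 0 \<or> u j = 1"
        unfolding cube_boundary_def by blast
      then have y: "y \<in> cell l N x"
        using up_cell by simp
      have "real N * y (e j) = a (e j) + u j"
        using up_free[OF eJ(1)[OF u(3)], of u] eJ(2)[OF u(3)] u(1) by simp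
      then have "real N * y (e j) \<in> \<int>"
        using u(4) unfolding a_def by auto
      then have "e j \<notin> free_coords l N y"
        unfolding free_coords_def by simp
      then have "free_coords l N y \<subset> free_coords l N x"
        using free_coords_mono[OF y] eJ(1)[OF u(3)] unfolding J_def by blast
      then show "y \<in> cell_rim l N x"
        using y psubset_card_mono[OF finite_free_coords] unfolding cell_rim_def cell_dim_def by blast
    qed
    show "down ` cell_rim l N x \<subseteq> cube_boundary m"
    proof
      fix u assume "u \<in> down ` cell_rim l N x"
      then obtain y where y: "u = down y" "y \<in> cell l N x" "cell_dim l N y < cell_dim l N x"
        unfolding cell_rim_def by blast
      then obtain i where i: "i \<in> J" "i \<notin> free_coords l N y"
        using free_coords_mono[OF y(2)] unfolding J_def cell_dim_def by (metis less_irrefl subsetI subset_antisym)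
      then have "real N * y i \<in> \<int>"
        using Jl unfolding free_coords_def by blast
      then obtain z where z: "real N * y i = of_int z"
        by (rule Ints_cases)
      have "z = \<lfloor>real N * x i\<rfloor> \<or> z = \<lfloor>real N * x i\<rfloor> + 1"
        using between[OF y(2) i(1)] unfolding z a_def by linarith
      then have "u (e' i) = 0 \<or> u (e' i) = 1"
        using e'm[OF i(1)] z by (auto simp: y(1) down_def a_def)
      then show "u \<in> cube_boundary m"
        using down_cube[OF y(2)] e'm(1)[OF i(1)] unfolding y(1) cube_boundary_def by blast
    qed
  qed
qed

lemma cell_compression:
  assumes conn: "k_connected_pair k T V" and x: "x \<in> topspace (cube l)" and "N > 0" and dim: "cell_dim l N x \<le> k"
    and f: "continuous_map (subtopology (cube l) (cell l N x)) T f"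
    and \<phi>: "continuous_map (prod_topology I01 (subtopology (cube l) (cell_rim l N x))) T \<phi>"
    and \<phi>0: "\<And>y. y \<in> cell_rim l N x \<Longrightarrow> \<phi> (0, y) = f y"
    and \<phi>1: "\<And>y. y \<in> cell_rim l N x \<Longrightarrow> \<phi> (1, y) \<in> V"
  obtains F where "continuous_map (prod_topology I01 (subtopology (cube l) (cell l N x))) T F"
    "\<And>y. y \<in> cell l N x \<Longrightarrow> F (0, y) = f y"
    "\<And>y. y \<in> cell l N x \<Longrightarrow> F (1, y) \<in> V"
    "\<And>t y. \<lbrakk>t \<in> {0..1}; y \<in> cell_rim l N x\<rbrakk> \<Longrightarrow> F (t, y) = \<phi> (min (2 * t) 1, y)"
proof -
  define m where "m = cell_dim l N x"
  obtain up down where up: "continuous_map (cube m) (subtopology (cube l) (cell l N x)) up"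
    and down: "continuous_map (subtopology (cube l) (cell l N x)) (cube m) down"
    and inv: "\<And>y. y \<in> cell l N x \<Longrightarrow> up (down y) = y"
    and up_bd: "up ` cube_boundary m \<subseteq> cell_rim l N x"
    and down_bd: "down ` cell_rim l N x \<subseteq> cube_boundary m"
    using cell_parametrization[OF x \<open>N > 0\<close>] unfolding m_def by metis
  have f': "continuous_map (cube m) T (f \<circ> up)"
    using up f by (rule continuous_map_compose)
  have "continuous_map (subtopology (cube m) (cube_boundary m)) (subtopology (cube l) (cell_rim l N x)) up"
    using up up_bd continuous_map_from_subtopology[of "cube m" "cube l" up "cube_boundary m"]
    unfolding continuous_map_in_subtopology by auto
  then have "continuous_map (prod_topology I01 (subtopology (cube m) (cube_boundary m)))
      (prod_topology I01 (subtopology (cube l) (cell_rim l N x))) (\<lambda>p. (fst p, up (snd p)))"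
    by (simp add: continuous_map_pairwise o_def continuous_map_fst continuous_map_compose[OF continuous_map_snd, unfolded o_def])
  from continuous_map_compose[OF this \<phi>]
  have \<phi>': "continuous_map (prod_topology I01 (subtopology (cube m) (cube_boundary m))) T (\<lambda>p. \<phi> (fst p, up (snd p)))"
    by (simp add: o_def)
  have "\<phi> (fst (0, u), up (snd (0, u))) = (f \<circ> up) u" "\<phi> (fst (1, u), up (snd (1, u))) \<in> V" if "u \<in> cube_boundary m" for u
    using \<phi>0 \<phi>1 up_bd that by auto
  from cube_compression[OF conn dim[folded m_def] f' \<phi>' this]
  obtain F where F: "continuous_map (prod_topology I01 (cube m)) T F"
    "\<And>u. u \<in> topspace (cube m) \<Longrightarrow> F (0, u) = (f \<circ> up) u"
    "\<And>u. u \<in> topspace (cube m) \<Longrightarrow> F (1, u) \<in> V"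
    "\<And>t u. \<lbrakk>t \<in> {0..1}; u \<in> cube_boundary m\<rbrakk> \<Longrightarrow> F (t, u) = \<phi> (fst (min (2 * t) 1, u), up (snd (min (2 * t) 1, u)))"
    by blast
  have down_cube: "down y \<in> topspace (cube m)" if "y \<in> cell l N x" for y
    using down that cell_subset_cube[of l N x] by (auto simp: continuous_map_def)
  show thesis
  proof (rule that[of "\<lambda>p. F (fst p, down (snd p))"])
    have "continuous_map (prod_topology I01 (subtopology (cube l) (cell l N x))) (prod_topology I01 (cube m))
        (\<lambda>p. (fst p, down (snd p)))"
      using down
      by (simp add: continuous_map_pairwise o_def continuous_map_fst continuous_map_compose[OF continuous_map_snd, unfolded o_def])
    from continuous_map_compose[OF this F(1)]
    show "continuous_map (prod_topology I01 (subtopology (cube l) (cell l N x))) T (\<lambda>p. F (fst p, down (snd p)))"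
      by (simp add: o_def)
    show "F (fst (t, y), down (snd (t, y))) = \<phi> (min (2 * t) 1, y)"
      if "t \<in> {0..1}" "y \<in> cell_rim l N x" for t y
    proof -
      have "y \<in> cell l N x"
        using that(2) cell_rim_subset_cell by blast
      then show ?thesis
        using F(4)[OF that(1), of "down y"] down_bd that(2) inv by auto
    qed
  qed (use F down_cube inv in auto)
qed

section \<open>Compression along the skeleta\<close>

definition skeleton :: "nat \<Rightarrow> nat \<Rightarrow> nat \<Rightarrow> (nat \<Rightarrow> real) set" where
  "skeleton l N j = {x \<in> topspace (cube l). cell_dim l N x < j}"

text \<open>
  A map on the \<open>l\<close>-cube together with a subdivision so fine that each cell whose image meets \<open>Y\<close> is mapped into a
  neighborhood \<open>W x\<close> with \<open>k\<close>-connected pair, increasing along faces. The neighborhood belongs to the cell and not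
  to the interior point \<open>x\<close> that names it, hence the last assumption.
\<close>
locale compression_grid =
  fixes X :: "'a topology" and Y :: "'a set" and k l N :: nat
    and f :: "(nat \<Rightarrow> real) \<Rightarrow> 'a" and W :: "(nat \<Rightarrow> real) \<Rightarrow> 'a set"
  assumes N: "N > 0" and l: "l \<le> k" and f: "continuous_map (cube l) X f"
    and conn: "\<And>x. \<lbrakk>x \<in> topspace (cube l); f ` cell l N x \<inter> Y \<noteq> {}\<rbrakk> \<Longrightarrow>
          k_connected_pair k (subtopology X (W x)) (W x - Y)"
    and image_cell: "\<And>x. \<lbrakk>x \<in> topspace (cube l); f ` cell l N x \<inter> Y \<noteq> {}\<rbrakk> \<Longrightarrow> f ` cell l N x \<subseteq> W x"
    and W_rim: "\<And>x y. \<lbrakk>x \<in> topspace (cube l); y \<in> cell_rim l N x; f ` cell l N y \<inter> Y \<noteq> {}\<rbrakk> \<Longrightarrow> W y \<subseteq> W x"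
    and W_cell: "\<And>x y. \<lbrakk>cell l N y = cell l N x; cell_dim l N y = cell_dim l N x\<rbrakk> \<Longrightarrow> W y = W x"
begin

text \<open>
  The invariant of the induction. Keeping the value \<open>f x\<close> where the cell of \<open>x\<close> misses \<open>Y\<close> makes the homotopy
  relative to the boundary of the cube; confining it to \<open>W x\<close> elsewhere keeps the homotopy on the rim of a
  larger cell inside the neighborhood of that cell.
\<close>
definition admissible :: "(nat \<Rightarrow> real) \<Rightarrow> 'a \<Rightarrow> bool" where
  "admissible x z \<longleftrightarrow> (if f ` cell l N x \<inter> Y = {} then z = f x else z \<in> W x)"

definition skeletal_compression :: "nat \<Rightarrow> (real \<times> (nat \<Rightarrow> real) \<Rightarrow> 'a) \<Rightarrow> bool" where
  "skeletal_compression j H \<longleftrightarrow>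
     continuous_map (prod_topology I01 (subtopology (cube l) (skeleton l N j))) X H \<and>
     (\<forall>x\<in>skeleton l N j. H (0, x) = f x \<and> H (1, x) \<notin> Y \<and> (\<forall>t\<in>{0..1}. admissible x (H (t, x))))"

text \<open>
  If the cell misses \<open>Y\<close>, so do its faces, and the constant homotopy at \<open>f\<close> has all required properties. Otherwise the homotopy
  on the rim stays in \<open>W x\<close>: on a face missing \<open>Y\<close> it is \<open>f\<close>, and on a face meeting \<open>Y\<close> it stays in the
  smaller neighborhood of that face. So \<open>cell_compression\<close> applies to the pair \<open>(W x, W x - Y)\<close>.
\<close>
lemma extend_over_cell:
  assumes H: "skeletal_compression j H" and x: "x \<in> topspace (cube l)" "cell_dim l N x = j"
  shows "\<exists>F. continuous_map (prod_topology I01 (subtopology (cube l) (cell l N x))) X F \<and>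
    (\<forall>y\<in>cell l N x. F (0, y) = f y \<and> F (1, y) \<notin> Y) \<and>
    (\<forall>t\<in>{0..1}. \<forall>y\<in>cell_rim l N x. F (t, y) = H (min (2 * t) 1, y)) \<and>
    (\<forall>t\<in>{0..1}. \<forall>y\<in>cell l N x. cell_dim l N y = j \<longrightarrow> admissible y (F (t, y)))"
proof -
  have rim: "cell_rim l N x \<subseteq> skeleton l N j"
    using cell_subset_cube[of l N x] x(2) unfolding cell_rim_def skeleton_def by blast
  have cont_f: "continuous_map (subtopology (cube l) (cell l N x)) X f"
    using f by (rule continuous_map_from_subtopology)
  have H0: "H (0, y) = f y" and H1: "H (1, y) \<notin> Y" and Hadm: "\<And>t. t \<in> {0..1} \<Longrightarrow> admissible y (H (t, y))"
    if "y \<in> cell_rim l N x" for y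
    using H rim that unfolding skeletal_compression_def by auto
  have sub: "f ` cell l N y \<subseteq> f ` cell l N x" if "y \<in> cell l N x" for y
    using cell_subset_cell[OF that] by blast
  show ?thesis
  proof (cases "f ` cell l N x \<inter> Y = {}")
    case True
    have "admissible y (f y)" if "y \<in> cell l N x" for y
      using sub[OF that] True unfolding admissible_def by auto
    moreover have "f y = H (min (2 * t) 1, y)" if t: "t \<in> {0..1}" and y: "y \<in> cell_rim l N x" for t y
    proof -
      have "f ` cell l N y \<inter> Y = {}"
        using sub[of y] y cell_rim_subset_cell True by blast
      then show ?thesis
        using Hadm[OF y, of "min (2 * t) 1"] t unfolding admissible_def by simp
    qed
    moreover have "continuous_map (prod_topology I01 (subtopology (cube l) (cell l N x))) X (f \<circ> snd)"
      using continuous_map_snd cont_f by (rule continuous_map_compose)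
    ultimately show ?thesis
      using True by (intro exI[of _ "f \<circ> snd"]) auto
  next
    case False
    let ?T = "subtopology X (W x)"
    have fW: "f ` cell l N x \<subseteq> W x"
      using image_cell x(1) False by blast
    have HW: "H (t, y) \<in> W x" if t: "t \<in> {0..1}" and y: "y \<in> cell_rim l N x" for t y
    proof (cases "f ` cell l N y \<inter> Y = {}")
      case True
      have yc: "y \<in> cell l N x"
        using y cell_rim_subset_cell by blast
      have "H (t, y) = f y"
        using Hadm[OF y t] True unfolding admissible_def by simp
      then show ?thesis
        using fW yc by auto
    next
      case False
      then have "H (t, y) \<in> W y"
        using Hadm[OF y t] unfolding admissible_def by simp
      then show ?thesis
        using W_rim[OF x(1) y False] by blast
    qed
    have "continuous_map (subtopology (cube l) (cell l N x)) ?T f"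
      unfolding continuous_map_in_subtopology using cont_f fW by auto
    moreover have "continuous_map (prod_topology I01 (subtopology (cube l) (cell_rim l N x))) ?T H"
      unfolding continuous_map_in_subtopology
    proof
      have "continuous_map (prod_topology I01 (subtopology (cube l) (skeleton l N j))) X H"
        using H unfolding skeletal_compression_def by blast
      moreover have "prod_topology I01 (subtopology (cube l) (cell_rim l N x)) =
          subtopology (prod_topology I01 (subtopology (cube l) (skeleton l N j))) (UNIV \<times> cell_rim l N x)"
        using rim by (simp add: subtopology_Times subtopology_subtopology Int_absorb1)
      ultimately show "continuous_map (prod_topology I01 (subtopology (cube l) (cell_rim l N x))) X H"
        by (simp only: continuous_map_from_subtopology)
      show "H \<in> topspace (prod_topology I01 (subtopology (cube l) (cell_rim l N x))) \<rightarrow> W x"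
        using HW by auto
    qed
    moreover have "cell_dim l N x \<le> k"
      using cell_dim_le l order_trans by blast
    moreover have "H (1, y) \<in> W x - Y" if "y \<in> cell_rim l N x" for y
      using HW[of 1 y] H1[OF that] that by simp
    ultimately obtain F where F: "continuous_map (prod_topology I01 (subtopology (cube l) (cell l N x))) ?T F"
      "\<And>y. y \<in> cell l N x \<Longrightarrow> F (0, y) = f y" "\<And>y. y \<in> cell l N x \<Longrightarrow> F (1, y) \<in> W x - Y"
      "\<And>t y. \<lbrakk>t \<in> {0..1}; y \<in> cell_rim l N x\<rbrakk> \<Longrightarrow> F (t, y) = H (min (2 * t) 1, y)"
      using cell_compression[OF conn[OF x(1) False] x(1) N, of f H] H0 by metis
    have "F (t, y) \<in> W x" if "t \<in> {0..1}" "y \<in> cell l N x" for t y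
      using F(1) that cell_subset_cube[of l N x] unfolding continuous_map_in_subtopology by (auto simp: Pi_iff)
    moreover have "W y = W x \<and> f ` cell l N y \<inter> Y \<noteq> {}" if "y \<in> cell l N x" "cell_dim l N y = j" for y
      using cell_eq_if_dim_eq[OF that(1)] W_cell that x(2) False by metis
    ultimately have "admissible y (F (t, y))" if "t \<in> {0..1}" "y \<in> cell l N x" "cell_dim l N y = j" for t y
      using that unfolding admissible_def by simp
    moreover have "continuous_map (prod_topology I01 (subtopology (cube l) (cell l N x))) X F"
      using F(1) by (rule continuous_map_into_fulltopology)
    ultimately show ?thesis
      using F(2-4) by (intro exI[of _ F]) simp
  qed
qed

text \<open>
  The extensions over the cells of dimension \<open>j\<close> agree with the slowed-down \<open>H\<close> on lower-dimensional
  points, and these cells overlap nowhere else, so one function \<open>H'\<close> restricts to all of them.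
\<close>
lemma extend_over_next_skeleton:
  assumes H: "skeletal_compression j H"
  shows "\<exists>H'. skeletal_compression (Suc j) H'"
proof -
  define top_cells where "top_cells = cell l N ` {x \<in> topspace (cube l). cell_dim l N x = j}"
  define extends where "extends = (\<lambda>C F.
    continuous_map (prod_topology I01 (subtopology (cube l) C)) X F \<and>
    (\<forall>y\<in>C. F (0, y) = f y \<and> F (1, y) \<notin> Y) \<and>
    (\<forall>t\<in>{0..1}. \<forall>y\<in>C. cell_dim l N y < j \<longrightarrow> F (t, y) = H (min (2 * t) 1, y)) \<and>
    (\<forall>t\<in>{0..1}. \<forall>y\<in>C. cell_dim l N y = j \<longrightarrow> admissible y (F (t, y))))"
  have "\<forall>C\<in>top_cells. \<exists>F. extends C F"
  proof
    fix C assume "C \<in> top_cells"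
    then obtain x where x: "C = cell l N x" "x \<in> topspace (cube l)" "cell_dim l N x = j"
      unfolding top_cells_def by blast
    show "\<exists>F. extends C F"
      using extend_over_cell[OF H x(2,3)] x(3) unfolding x(1) cell_rim_def extends_def
      by (simp add: Ball_def imp_conjL)
  qed
  \<comment> \<open>The extension is chosen per cell, not per interior point, so that it is one map on each cell.\<close>
  from bchoice[OF this] obtain F where "\<forall>C\<in>top_cells. extends C (F C)" ..
  then have F: "\<And>C. C \<in> top_cells \<Longrightarrow> continuous_map (prod_topology I01 (subtopology (cube l) C)) X (F C)"
      "\<And>C y. \<lbrakk>C \<in> top_cells; y \<in> C\<rbrakk> \<Longrightarrow> F C (0, y) = f y"
      "\<And>C y. \<lbrakk>C \<in> top_cells; y \<in> C\<rbrakk> \<Longrightarrow> F C (1, y) \<notin> Y"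
      "\<And>C t y. \<lbrakk>C \<in> top_cells; t \<in> {0..1}; y \<in> C; cell_dim l N y < j\<rbrakk> \<Longrightarrow> F C (t, y) = H (min (2 * t) 1, y)"
      "\<And>C t y. \<lbrakk>C \<in> top_cells; t \<in> {0..1}; y \<in> C; cell_dim l N y = j\<rbrakk> \<Longrightarrow> admissible y (F C (t, y))"
    unfolding extends_def by blast+
  define H' where "H' = (\<lambda>p. if cell_dim l N (snd p) < j then H (min (2 * fst p) 1, snd p)
      else F (cell l N (snd p)) p)"
  have H'_top: "H' (t, y) = F C (t, y)" if C: "C \<in> top_cells" and t: "t \<in> {0..1}" and y: "y \<in> C" for C t y
  proof (cases "cell_dim l N y < j")
    case True
    then show ?thesis
      using F(4)[OF C t y] by (simp add: H'_def)
  next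
    case False
    obtain x where x: "C = cell l N x" "cell_dim l N x = j"
      using C unfolding top_cells_def by blast
    have "cell_dim l N y = cell_dim l N x"
      using False cell_dim_mono[of y l N x] y x by simp
    then have "cell l N y = C"
      using cell_eq_if_dim_eq y x by simp
    then show ?thesis
      using False by (simp add: H'_def)
  qed
  have own: "cell l N x \<in> top_cells" "x \<in> cell l N x"
    if "x \<in> skeleton l N (Suc j)" "\<not> cell_dim l N x < j" for x
    using that mem_own_cell unfolding top_cells_def skeleton_def by auto
  define Z where "Z = prod_topology I01 (subtopology (cube l) (skeleton l N (Suc j)))"
  define cells where "cells = cell l N ` skeleton l N (Suc j)"
  have cell_skeleton: "cell l N x \<subseteq> skeleton l N i" if "x \<in> skeleton l N i" for x i
    using that cell_subset_cube[of l N x] cell_dim_mono[of _ l N x] unfolding skeleton_def by force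
  have sub_Z: "subtopology Z ({0..1} \<times> C) = prod_topology I01 (subtopology (cube l) C)" if "C \<in> cells" for C
    using that cell_skeleton unfolding Z_def cells_def
    by (auto simp: subtopology_Times subtopology_subtopology Int_absorb1)
  have cont_H: "continuous_map (prod_topology I01 (subtopology (cube l) C)) X (\<lambda>p. H (min (2 * fst p) 1, snd p))"
    if C: "C \<subseteq> skeleton l N j" for C
  proof -
    have "continuous_map (prod_topology I01 (subtopology (cube l) C)) I01 (\<lambda>p. min (2 * fst p) 1)"
      unfolding continuous_map_in_subtopology
      by (auto intro!: continuous_map_real_min continuous_map_real_mult_left continuous_map_prod_time)
    moreover have "continuous_map (prod_topology I01 (subtopology (cube l) C)) (subtopology (cube l) (skeleton l N j)) snd"
      using continuous_map_snd[of I01 "subtopology (cube l) C"] C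
      unfolding continuous_map_in_subtopology by auto
    ultimately have "continuous_map (prod_topology I01 (subtopology (cube l) C))
        (prod_topology I01 (subtopology (cube l) (skeleton l N j))) (\<lambda>p. (min (2 * fst p) 1, snd p))"
      by (simp add: continuous_map_pairwise o_def)
    moreover have "continuous_map (prod_topology I01 (subtopology (cube l) (skeleton l N j))) X H"
      using H unfolding skeletal_compression_def by blast
    ultimately have "continuous_map (prod_topology I01 (subtopology (cube l) C)) X (H \<circ> (\<lambda>p. (min (2 * fst p) 1, snd p)))"
      by (rule continuous_map_compose)
    then show ?thesis
      by (simp add: o_def)
  qed
  have "continuous_map Z X H'"
  proof (rule pasting_lemma_closed[where I = cells and T = "\<lambda>C. {0..1} \<times> C" and f = "\<lambda>_. H'"])
    have "cells \<subseteq> cell l N ` topspace (cube l)"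
      unfolding cells_def skeleton_def by blast
    then show "finite cells"
      using finite_cells finite_subset by blast
    show "closedin Z ({0..1} \<times> C)" if C: "C \<in> cells" for C
    proof -
      obtain x where x: "C = cell l N x" "x \<in> skeleton l N (Suc j)"
        using C unfolding cells_def by blast
      have "closedin (subtopology (cube l) (skeleton l N (Suc j))) C"
        unfolding x(1) by (rule closedin_subset_topspace[OF closedin_cell cell_skeleton[OF x(2)]])
      moreover have "closedin I01 {0..1}"
        by simp
      ultimately show ?thesis
        unfolding Z_def by (simp add: closedin_prod_Times_iff)
    qed
    show "continuous_map (subtopology Z ({0..1} \<times> C)) X H'" if C: "C \<in> cells" for C
      unfolding sub_Z[OF C]
    proof (cases "C \<in> top_cells")
      case True
      show "continuous_map (prod_topology I01 (subtopology (cube l) C)) X H'"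
        by (rule continuous_map_eq[OF F(1)[OF True]]) (use H'_top[OF True] in auto)
    next
      case False
      obtain x where x: "C = cell l N x" "x \<in> skeleton l N (Suc j)"
        using C unfolding cells_def by blast
      then have "x \<in> skeleton l N j"
        using False unfolding top_cells_def skeleton_def by auto
      then have Cj: "C \<subseteq> skeleton l N j"
        unfolding x(1) by (rule cell_skeleton)
      show "continuous_map (prod_topology I01 (subtopology (cube l) C)) X H'"
        by (rule continuous_map_eq[OF cont_H[OF Cj]]) (use Cj in \<open>auto simp: H'_def skeleton_def\<close>)
    qed
    show "\<exists>C. C \<in> cells \<and> p \<in> {0..1} \<times> C \<and> H' p = H' p" if "p \<in> topspace Z" for p
    proof -
      have "snd p \<in> skeleton l N (Suc j)" "snd p \<in> topspace (cube l)" "fst p \<in> {0..1}"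
        using that unfolding Z_def by auto
      then show ?thesis
        using mem_own_cell[of "snd p" l N] unfolding cells_def
        by (intro exI[of _ "cell l N (snd p)"]) (auto simp: mem_Times_iff)
    qed
  qed simp
  moreover have "H' (0, x) = f x \<and> H' (1, x) \<notin> Y \<and> (\<forall>t\<in>{0..1}. admissible x (H' (t, x)))"
    if x: "x \<in> skeleton l N (Suc j)" for x
  proof (cases "cell_dim l N x < j")
    case True
    then have "x \<in> skeleton l N j"
      using x unfolding skeleton_def by simp
    then show ?thesis
      using H True unfolding skeletal_compression_def by (simp add: H'_def)
  next
    case False
    then have "cell_dim l N x = j"
      using x unfolding skeleton_def by simp
    then show ?thesis
      using F(2,3,5)[OF own(1)[OF x False]] own(2)[OF x False] False by (simp add: H'_def)
  qed
  ultimately show ?thesis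
    unfolding skeletal_compression_def Z_def by blast
qed

lemma ex_skeletal_compression: "\<exists>H. skeletal_compression j H"
proof (induction j)
  case 0
  have "skeleton l N 0 = {}"
    unfolding skeleton_def by simp
  then show ?case
    unfolding skeletal_compression_def by (simp add: continuous_map_on_empty)
next
  case (Suc j)
  then show ?case
    using extend_over_next_skeleton by blast
qed

lemma ex_compression:
  obtains H where "continuous_map (prod_topology I01 (cube l)) X H"
    "\<And>x. x \<in> topspace (cube l) \<Longrightarrow> H (0, x) = f x"
    "\<And>x. x \<in> topspace (cube l) \<Longrightarrow> H (1, x) \<in> topspace X - Y"
    "\<And>t x. \<lbrakk>x \<in> topspace (cube l); f ` cell l N x \<inter> Y = {}; t \<in> {0..1}\<rbrakk> \<Longrightarrow> H (t, x) = f x"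
proof -
  obtain H where H: "skeletal_compression (Suc l) H"
    using ex_skeletal_compression by blast
  have skel: "skeleton l N (Suc l) = topspace (cube l)"
    using cell_dim_le unfolding skeleton_def by (auto simp: less_Suc_eq_le)
  then have cont: "continuous_map (prod_topology I01 (cube l)) X H"
    using H unfolding skeletal_compression_def by simp
  then have "H (1, x) \<in> topspace X" if "x \<in> topspace (cube l)" for x
    using that unfolding continuous_map_def by auto
  then show thesis
    using H cont unfolding skeletal_compression_def skel admissible_def
    by (intro that[of H]) simp_all
qed

end

section \<open>From local to global connectedness\<close>

text \<open>
  The mesh is chosen after the neighborhoods: \<open>2 / N\<close> bounds the diameter of the cells and has to
  stay below the size \<open>\<delta>\<close> for which \<open>nested_neighborhoods\<close> provides them. Indexing the neighborhood of
  a cell by its dimension makes it increase along proper faces.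
\<close>
lemma compression_into_complement:
  assumes Y: "closedin X Y" and base: "\<forall>y\<in>Y. neighbourhood_base_at y (\<lambda>U. k_connected_pair k (subtopology X U) (U - Y)) X"
    and "l \<le> k" and f: "continuous_map (cube l) X f" and bd: "f ` cube_boundary l \<subseteq> topspace X - Y"
  shows "\<exists>g. homotopic_with (\<lambda>h. \<forall>x\<in>cube_boundary l. h x = f x) (cube l) X f g \<and>
     g ` topspace (cube l) \<subseteq> topspace X - Y"
proof -
  define K where "K = topspace (cube l)"
  have "compact K"
    unfolding K_def by (rule compact_topspace_cube)
  have fK: "continuous_map (top_of_set K) X f"
    using continuous_map_compose[OF continuous_map_top_of_set_cube f] unfolding K_def by (simp add: o_def)
  obtain \<delta> U where "\<delta> > 0"
    and U: "\<And>A j. \<lbrakk>A \<in> meeting_sets K f Y \<delta>; j \<le> l\<rbrakk> \<Longrightarrow>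
        k_connected_pair k (subtopology X (U j A)) (U j A - Y) \<and> f ` A \<subseteq> U j A"
    and U_mono: "\<And>A B i j. \<lbrakk>A \<in> meeting_sets K f Y \<delta>; B \<in> meeting_sets K f Y \<delta>; A \<subseteq> B; i < j; j \<le> l\<rbrakk>
       \<Longrightarrow> U i A \<subseteq> U j B"
    by (rule nested_neighborhoods[OF \<open>compact K\<close> fK Y base, where n = l]) (rule that, assumption+)
  obtain N where N: "N > 0" "inverse (real N) < \<delta> / 2"
    using ex_inverse_of_nat_less[of "\<delta> / 2"] \<open>\<delta> > 0\<close> by auto
  have small: "cell l N x \<in> meeting_sets K f Y \<delta>" if "f ` cell l N x \<inter> Y \<noteq> {}" for x
  proof -
    have "diameter (cell l N x) \<le> \<delta>"
      using diameter_cell_le[OF N(1), of l x] N(2) by (simp add: inverse_eq_divide)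
    then show ?thesis
      using that cell_subset_cube unfolding meeting_sets_def K_def by blast
  qed
  define W where "W = (\<lambda>x. U (cell_dim l N x) (cell l N x))"
  interpret compression_grid X Y k l N f W
  proof
    show "W y \<subseteq> W x" if "y \<in> cell_rim l N x" "f ` cell l N y \<inter> Y \<noteq> {}" for x y
    proof -
      have y: "cell l N y \<subseteq> cell l N x" "cell_dim l N y < cell_dim l N x"
        using that(1) cell_subset_cell unfolding cell_rim_def by auto
      have "f ` cell l N x \<inter> Y \<noteq> {}"
        using that(2) y(1) by blast
      then show ?thesis
        unfolding W_def by (intro U_mono small that y cell_dim_le)
    qed
  qed (use N(1) \<open>l \<le> k\<close> f U[OF small cell_dim_le] in \<open>auto simp: W_def\<close>)
  obtain H where H: "continuous_map (prod_topology I01 (cube l)) X H"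
    "\<And>x. x \<in> topspace (cube l) \<Longrightarrow> H (0, x) = f x"
    "\<And>x. x \<in> topspace (cube l) \<Longrightarrow> H (1, x) \<in> topspace X - Y"
    "\<And>t x. \<lbrakk>x \<in> topspace (cube l); f ` cell l N x \<inter> Y = {}; t \<in> {0..1}\<rbrakk> \<Longrightarrow> H (t, x) = f x"
    by (rule ex_compression) (rule that, assumption+)
  have H_boundary: "H (t, x) = f x" if "x \<in> cube_boundary l" "t \<in> {0..1}" for t x
  proof (rule H(4))
    show "x \<in> topspace (cube l)"
      using that(1) unfolding cube_boundary_def by blast
    show "f ` cell l N x \<inter> Y = {}"
      using cell_boundary_point_subset[OF that(1) N(1)] bd by blast
  qed (rule that(2))
  \<comment> \<open>\<open>homotopic_with\<close> prescribes the initial map at all points of the type, also outside the cube.\<close>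
  define H' where "H' = (\<lambda>p. if snd p \<in> topspace (cube l) then H p else f (snd p))"
  have "continuous_map (prod_topology I01 (cube l)) X H'"
    by (rule continuous_map_eq[OF H(1)]) (auto simp: H'_def)
  moreover have "\<forall>x. H' (0, x) = f x"
    using H(2) by (simp add: H'_def)
  moreover have "\<forall>t\<in>{0..1}. \<forall>x\<in>cube_boundary l. H' (t, x) = f x"
    using H_boundary by (simp add: H'_def)
  ultimately have "homotopic_with (\<lambda>h. \<forall>x\<in>cube_boundary l. h x = f x) (cube l) X f (\<lambda>x. H' (1, x))"
    unfolding homotopic_with_def by blast
  moreover have "(\<lambda>x. H' (1, x)) ` topspace (cube l) \<subseteq> topspace X - Y"
    using H(3) by (auto simp: H'_def)
  ultimately show ?thesis
    by blast
qed

lemma path_into_complement: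
  assumes base: "\<forall>y\<in>Y. neighbourhood_base_at y (\<lambda>U. k_connected_pair k (subtopology X U) (U - Y)) X"
    and x: "x \<in> topspace X"
  shows "\<exists>p. pathin X p \<and> p 0 = x \<and> p 1 \<in> topspace X - Y"
proof (cases "x \<in> Y")
  case True
  then obtain U where U: "k_connected_pair k (subtopology X U) (U - Y)" "x \<in> U"
    using base x unfolding neighbourhood_base_at_def by (meson openin_topspace subsetD)
  then obtain p where p: "pathin (subtopology X U) p" "p 0 = x" "p 1 \<in> U - Y"
    using k_connected_pair_path[OF U(1), of x] x by auto
  then have "pathin X p"
    by (simp add: pathin_subtopology)
  moreover from this have "p 1 \<in> topspace X"
    unfolding pathin_def continuous_map_def by auto
  ultimately show ?thesis
    using p by blast
next
  case False
  then show ?thesis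
    using x by (intro exI[of _ "\<lambda>_. x"]) (simp add: pathin_const)
qed

theorem theoremD:
  fixes X :: "'a topology" and Y :: "'a set" and k :: nat
  assumes "Hausdorff_space X"
    and "closedin X Y"
    and "\<And>y. y \<in> Y \<Longrightarrow>
           \<exists>\<U>. neighborhood_system X y \<U> \<and>
               (\<forall>U\<in>\<U>. k_connected_pair k (subtopology X U) (U - Y))"
  shows "k_connected_pair k X (topspace X - Y)"
proof -
  have base: "\<forall>y\<in>Y. neighbourhood_base_at y (\<lambda>U. k_connected_pair k (subtopology X U) (U - Y)) X"
    using assms(3) unfolding ex_neighborhood_system_iff by blast
  show ?thesis
    unfolding k_connected_pair_def[of k X]
  proof (intro conjI ballI allI impI)
    show "\<exists>p. pathin X p \<and> p 0 = x \<and> p 1 \<in> topspace X - Y" if "x \<in> topspace X" for x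
      using base that by (rule path_into_complement)
    show "\<exists>g. homotopic_with (\<lambda>h. \<forall>x\<in>cube_boundary l. h x = f x) (cube l) X f g \<and>
        g ` topspace (cube l) \<subseteq> topspace X - Y"
      if "1 \<le> l \<and> l \<le> k \<and> continuous_map (cube l) X f \<and> f ` cube_boundary l \<subseteq> topspace X - Y" for l f
      using that by (intro compression_into_complement[OF assms(2) base]) simp_all
  qed
qed

end
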